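(* For every Lebesgue dynamical system $(X,\nu,\tau)$ there exist a transitive Loeb dynamical system $(Y,\mu_L,T)$ and a measure preserving map $\psi:Y\to X$ such that $\psi(T(y))=\tau(\psi(y))$ for $\mu_L$-almost all $y\in Y$; that is, every Lebesgue dynamical system is a homomorphic image of an appropriate transitive Loeb dynamical system.
   Context: We work in an $\aleph_1$-saturated nonstandard universe. A Lebesgue space is a probability space isomorphic modulo measure $0$ to $[0,1]$ with Lebesgue measure, or to a countable space with an atomic measure, or to the (suitably weighted) direct sum of the previous two. A Lebesgue dynamical system $(X,\nu,\tau)$ is a Lebesgue space $(X,\nu)$ together with a measure preserving transformation $\tau:X\to X$. A transitive Loeb dynamical system $(Y,\mu_L,T)$ consists of a hyperfinite set $Y$ of infinite internal cardinality $M$, the Loeb measure $\mu_L$ on $Y$ obtained from the normalized counting measure $B\mapsto{}^\circ(|B|/M)$ on internal subsets $B\subseteq Y$ (extended to the generated $\sigma$-algebra and completed), and an internal permutation $T:Y\to Y$ which is a single cycle of length $M$. *)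

theory Defs
  imports "HOL-Probability.Probability"
begin

section \<open>Nonstandard universes\<close>

text \<open>
  The standard individuals form a type \<open>'u\<close>, which contains the natural numbers through
  the injection \<open>num\<close>; the individuals of the nonstandard universe form a type \<open>'v\<close>.
  Every individual \<open>a\<close> has a copy \<open>emb a\<close> and every relation \<open>R\<close>
  between standard individuals (a set of tuples, written as lists) has an extension \<open>star R\<close>.
  The Transfer Principle is stated for all first-order formulas in which every relation on
  \<open>'u\<close> may occur as a relation symbol.
\<close>

datatype 'u formula =
    Rel "'u list set" "nat list"
  | Equal nat nat
  | Neg "'u formula"
  | Conj "'u formula" "'u formula"
  | Exists nat "'u formula"

primrec holds :: "('u list set \<Rightarrow> 'v list set) \<Rightarrow> 'u formula \<Rightarrow> (nat \<Rightarrow> 'v) \<Rightarrow> bool" where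
  "holds I (Rel R xs) e \<longleftrightarrow> map e xs \<in> I R"
| "holds I (Equal x y) e \<longleftrightarrow> e x = e y"
| "holds I (Neg \<phi>) e \<longleftrightarrow> \<not> holds I \<phi> e"
| "holds I (Conj \<phi> \<theta>) e \<longleftrightarrow> holds I \<phi> e \<and> holds I \<theta> e"
| "holds I (Exists x \<phi>) e \<longleftrightarrow> (\<exists>a. holds I \<phi> (e(x := a)))"

record ('u, 'v) ns_universe =
  num :: "nat \<Rightarrow> 'u"
  emb :: "'u \<Rightarrow> 'v"
  star :: "'u list set \<Rightarrow> 'v list set"

definition transfer_principle :: "('u, 'v) ns_universe \<Rightarrow> bool" where
  "transfer_principle U \<longleftrightarrow>
     (\<forall>\<phi> e. holds (\<lambda>R. R) \<phi> e \<longleftrightarrow> holds (star U) \<phi> (emb U \<circ> e))"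

text \<open>
  Internal sets are the members of extensions of standard families of sets: if
  \<open>E\<close> codes the family of the sections \<open>{x. x # ps \<in> E}\<close>, the members of the
  extended family are the sections of \<open>star E\<close> at arbitrary, possibly nonstandard,
  parameters.  Likewise for binary relations.
\<close>

definition internal_set :: "('u, 'v) ns_universe \<Rightarrow> 'v set \<Rightarrow> bool" where
  "internal_set U A \<longleftrightarrow> (\<exists>E ps. A = {x. x # ps \<in> star U E})"

definition internal_rel :: "('u, 'v) ns_universe \<Rightarrow> ('v \<times> 'v) set \<Rightarrow> bool" where
  "internal_rel U G \<longleftrightarrow> (\<exists>E ps. G = {(x, y). x # y # ps \<in> star U E})"

definition internal_fun_on :: "('u, 'v) ns_universe \<Rightarrow> 'v set \<Rightarrow> ('v \<Rightarrow> 'v) \<Rightarrow> bool" where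
  "internal_fun_on U A f \<longleftrightarrow> internal_rel U {(x, f x) |x. x \<in> A}"

definition aleph1_saturated :: "('u, 'v) ns_universe \<Rightarrow> bool" where
  "aleph1_saturated U \<longleftrightarrow>
     (\<forall>A :: nat \<Rightarrow> 'v set.
        (\<forall>n. internal_set U (A n)) \<and> (\<forall>n. (\<Inter>k\<le>n. A k) \<noteq> {}) \<longrightarrow> (\<Inter>n. A n) \<noteq> {})"

definition nonstandard_universe :: "('u, 'v) ns_universe \<Rightarrow> bool" where
  "nonstandard_universe U \<longleftrightarrow> inj (num U) \<and> transfer_principle U \<and> aleph1_saturated U"


section \<open>Hyperfinite sets\<close>

definition hnat :: "('u, 'v) ns_universe \<Rightarrow> 'v set" where
  "hnat U = {k. [k] \<in> star U {[num U n] |n. True}}"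

definition hless :: "('u, 'v) ns_universe \<Rightarrow> 'v \<Rightarrow> 'v \<Rightarrow> bool" where
  "hless U k m \<longleftrightarrow> [k, m] \<in> star U {[num U i, num U j] |i j. i < j}"

definition hbelow :: "('u, 'v) ns_universe \<Rightarrow> 'v \<Rightarrow> 'v set" where
  "hbelow U m = {k \<in> hnat U. hless U k m}"

definition has_hcard :: "('u, 'v) ns_universe \<Rightarrow> 'v set \<Rightarrow> 'v \<Rightarrow> bool" where
  "has_hcard U A m \<longleftrightarrow>
     m \<in> hnat U \<and> (\<exists>f. internal_fun_on U (hbelow U m) f \<and> bij_betw f (hbelow U m) A)"

definition hyperfinite :: "('u, 'v) ns_universe \<Rightarrow> 'v set \<Rightarrow> bool" where
  "hyperfinite U A \<longleftrightarrow> internal_set U A \<and> (\<exists>m. has_hcard U A m)"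

definition hcard :: "('u, 'v) ns_universe \<Rightarrow> 'v set \<Rightarrow> 'v" where
  "hcard U A = (THE m. has_hcard U A m)"

definition infinite_hnat :: "('u, 'v) ns_universe \<Rightarrow> 'v \<Rightarrow> bool" where
  "infinite_hnat U m \<longleftrightarrow> m \<in> hnat U \<and> (\<forall>n. hless U (emb U (num U n)) m)"

text \<open>
  The standard part of the hyperrational \<open>b / m\<close>: the only standard real \<open>r\<close>
  such that \<open>\<bar>b / m - r\<bar> < \<epsilon>\<close>, read in the nonstandard universe, for all standard
  \<open>\<epsilon> > 0\<close>.
\<close>

definition st_quotient :: "('u, 'v) ns_universe \<Rightarrow> 'v \<Rightarrow> 'v \<Rightarrow> real" where
  "st_quotient U b m =
     (THE r. \<forall>\<epsilon>>0. [b, m] \<in> star U {[num U i, num U j] |i j. \<bar>real i / real j - r\<bar> < \<epsilon>})"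


section \<open>Loeb measure\<close>

definition loeb_measure :: "('u, 'v) ns_universe \<Rightarrow> 'v set \<Rightarrow> 'v measure" where
  "loeb_measure U Y =
     completion (extend_measure Y {B. B \<subseteq> Y \<and> internal_set U B} (\<lambda>B. B)
       (\<lambda>B. ennreal (st_quotient U (hcard U B) (hcard U Y))))"

text \<open>
  A single cycle of length \<open>M\<close> on \<open>Y\<close> is, internally, a permutation of the form
  \<open>(c 0, c 1, \<dots>, c (M - 1))\<close>, where \<open>c\<close> enumerates \<open>Y\<close>.
\<close>

definition hcycle_on :: "('u, 'v) ns_universe \<Rightarrow> 'v set \<Rightarrow> 'v \<Rightarrow> ('v \<Rightarrow> 'v) \<Rightarrow> bool" where
  "hcycle_on U Y M T \<longleftrightarrow>
     (\<exists>c. internal_fun_on U (hbelow U M) c \<and> bij_betw c (hbelow U M) Y \<and>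
        (\<forall>k\<in>hbelow U M. \<forall>l\<in>hbelow U M.
           [k, l, M] \<in> star U {[num U i, num U j, num U n] |i j n. j = Suc i mod n} \<longrightarrow>
           T (c k) = c l))"

definition transitive_loeb_system ::
    "('u, 'v) ns_universe \<Rightarrow> 'v set \<Rightarrow> ('v \<Rightarrow> 'v) \<Rightarrow> bool" where
  "transitive_loeb_system U Y T \<longleftrightarrow>
     hyperfinite U Y \<and> infinite_hnat U (hcard U Y) \<and>
     internal_fun_on U Y T \<and> bij_betw T Y Y \<and> hcycle_on U Y (hcard U Y) T"


section \<open>Lebesgue dynamical systems\<close>

definition measure_preserving :: "'a measure \<Rightarrow> 'b measure \<Rightarrow> ('a \<Rightarrow> 'b) \<Rightarrow> bool" where
  "measure_preserving M N f \<longleftrightarrow>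
     f \<in> measurable M N \<and>
     (\<forall>A\<in>sets N. emeasure M (f -` A \<inter> space M) = emeasure N A)"

definition measure_isomorphism :: "'a measure \<Rightarrow> 'b measure \<Rightarrow> ('a \<Rightarrow> 'b) \<Rightarrow> bool" where
  "measure_isomorphism M N f \<longleftrightarrow>
     bij_betw f (space M) (space N) \<and> measure_preserving M N f \<and>
     measure_preserving N M (the_inv_into (space M) f)"

definition isomorphic_mod_0 :: "'a measure \<Rightarrow> 'b measure \<Rightarrow> bool" where
  "isomorphic_mod_0 M N \<longleftrightarrow>
     (\<exists>A\<in>null_sets M. \<exists>B\<in>null_sets N. \<exists>f.
        measure_isomorphism (restrict_space M (space M - A)) (restrict_space N (space N - B)) f)"

definition weighted_sum :: "real \<Rightarrow> 'a measure \<Rightarrow> 'b measure \<Rightarrow> ('a + 'b) measure" where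
  "weighted_sum \<alpha> M N =
     measure_of (space M <+> space N) {A <+> B |A B. A \<in> sets M \<and> B \<in> sets N}
       (\<lambda>S. ennreal \<alpha> * emeasure M (Inl -` S) + ennreal (1 - \<alpha>) * emeasure N (Inr -` S))"

text \<open>
  Up to isomorphism, the countable spaces with an atomic probability measure are the
  spaces \<open>measure_pmf p\<close> with \<open>p :: nat pmf\<close>.
\<close>

definition lebesgue_space :: "'a measure \<Rightarrow> bool" where
  "lebesgue_space X \<longleftrightarrow> prob_space X \<and>
     (isomorphic_mod_0 X (lebesgue_on {0..1::real}) \<or>
      (\<exists>p :: nat pmf. isomorphic_mod_0 X (measure_pmf p)) \<or>
      (\<exists>(p :: nat pmf) \<alpha>. 0 < \<alpha> \<and> \<alpha> < 1 \<and>
         isomorphic_mod_0 X (weighted_sum \<alpha> (lebesgue_on {0..1::real}) (measure_pmf p))))"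

definition lebesgue_dynamical_system :: "'a measure \<Rightarrow> ('a \<Rightarrow> 'a) \<Rightarrow> bool" where
  "lebesgue_dynamical_system X \<tau> \<longleftrightarrow> lebesgue_space X \<and> measure_preserving X X \<tau>"


section \<open>The direct sum is the expected measure\<close>

lemma sigma_algebra_weighted_sum:
  "sigma_algebra (space M <+> space N) {A <+> B |A B. A \<in> sets M \<and> B \<in> sets N}"
    (is "sigma_algebra ?S ?E")
  unfolding sigma_algebra_iff2
proof (intro conjI ballI allI impI)
  show "?E \<subseteq> Pow ?S"
  proof
    fix S assume "S \<in> ?E"
    then obtain A B where S: "S = A <+> B" "A \<in> sets M" "B \<in> sets N" by blast
    have "A \<subseteq> space M" "B \<subseteq> space N" using S(2,3) by (auto dest: sets.sets_into_space)
    then show "S \<in> Pow ?S" unfolding S(1) by blast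
  qed
  have "({} :: ('a + 'b) set) = {} <+> {}" by blast
  then show "{} \<in> ?E" by blast
next
  fix S assume "S \<in> ?E"
  then obtain A B where S: "S = A <+> B" "A \<in> sets M" "B \<in> sets N" by blast
  have "?S - S = (space M - A) <+> (space N - B)" unfolding S(1) by blast
  moreover have "space M - A \<in> sets M" "space N - B \<in> sets N" using S(2,3) by auto
  ultimately show "?S - S \<in> ?E" by blast
next
  fix F :: "nat \<Rightarrow> ('a + 'b) set" assume "range F \<subseteq> ?E"
  then have "\<forall>i. \<exists>A B. F i = A <+> B \<and> A \<in> sets M \<and> B \<in> sets N" by blast
  then obtain A B where F: "\<And>i. F i = A i <+> B i" "\<And>i. A i \<in> sets M" "\<And>i. B i \<in> sets N"
    by metis
  have "\<Union> (range F) = (\<Union>i. A i) <+> (\<Union>i. B i)" unfolding F(1) by blast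
  moreover have "(\<Union>i. A i) \<in> sets M" "(\<Union>i. B i) \<in> sets N" using F(2,3) by auto
  ultimately show "\<Union> (range F) \<in> ?E" by blast
qed

lemma space_weighted_sum: "space (weighted_sum \<alpha> M N) = space M <+> space N"
  unfolding weighted_sum_def
  by (rule space_measure_of, rule sigma_algebra.axioms(1)[OF sigma_algebra_weighted_sum,
        THEN algebra.axioms(1), THEN ring_of_sets.axioms(1), THEN semiring_of_sets.axioms(1),
        THEN subset_class.space_closed])

lemma sets_weighted_sum:
  "sets (weighted_sum \<alpha> M N) = {A <+> B |A B. A \<in> sets M \<and> B \<in> sets N}"
  unfolding weighted_sum_def
  by (rule sigma_algebra.sets_measure_of_eq[OF sigma_algebra_weighted_sum])

lemma emeasure_weighted_sum:
  assumes "A \<in> sets M" "B \<in> sets N"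
  shows "emeasure (weighted_sum \<alpha> M N) (A <+> B) =
    ennreal \<alpha> * emeasure M A + ennreal (1 - \<alpha>) * emeasure N B"
proof -
  let ?\<mu> = "\<lambda>S. ennreal \<alpha> * emeasure M (Inl -` S) + ennreal (1 - \<alpha>) * emeasure N (Inr -` S)"
  have vimage: "Inl -` (A <+> B) = A" "Inr -` (A <+> B) = B" for A :: "'a set" and B :: "'b set"
    by blast+
  have in_sets: "Inl -` S \<in> sets M" "Inr -` S \<in> sets N"
    if S: "S \<in> sets (weighted_sum \<alpha> M N)" for S
  proof -
    obtain A B where "S = A <+> B" "A \<in> sets M" "B \<in> sets N"
      using S unfolding sets_weighted_sum by blast
    then show "Inl -` S \<in> sets M" "Inr -` S \<in> sets N" by (simp_all only: vimage)
  qed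
  have "emeasure (weighted_sum \<alpha> M N) (A <+> B) = ?\<mu> (A <+> B)"
  proof (rule emeasure_measure_of[OF weighted_sum_def])
    show "{A <+> B |A B. A \<in> sets M \<and> B \<in> sets N} \<subseteq> Pow (space M <+> space N)"
      using sets.space_closed[of "weighted_sum \<alpha> M N"]
      unfolding sets_weighted_sum space_weighted_sum .
    show "A <+> B \<in> sets (weighted_sum \<alpha> M N)"
      using assms unfolding sets_weighted_sum by blast
    show "positive (sets (weighted_sum \<alpha> M N)) ?\<mu>"
      unfolding positive_def by simp
    show "countably_additive (sets (weighted_sum \<alpha> M N)) ?\<mu>"
    proof (rule countably_additiveI)
      fix F :: "nat \<Rightarrow> ('a + 'b) set"
      assume F: "range F \<subseteq> sets (weighted_sum \<alpha> M N)" "disjoint_family F"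
      have Fi: "F i \<in> sets (weighted_sum \<alpha> M N)" for i using F(1) by blast
      have l: "range (\<lambda>i. Inl -` F i) \<subseteq> sets M" and r: "range (\<lambda>i. Inr -` F i) \<subseteq> sets N"
        using in_sets[OF Fi] by blast+
      have dl: "disjoint_family (\<lambda>i. Inl -` F i)" and dr: "disjoint_family (\<lambda>i. Inr -` F i)"
        using F(2) unfolding disjoint_family_on_def by blast+
      show "(\<Sum>i. ?\<mu> (F i)) = ?\<mu> (\<Union> (range F))"
        unfolding vimage_UN suminf_emeasure[OF l dl, symmetric] suminf_emeasure[OF r dr, symmetric]
        by (simp add: suminf_add[symmetric])
    qed
  qed
  then show ?thesis unfolding vimage .
qed

end

theory Submission
  imports Defs
begin

text \<open>
  Why the theorem holds.  A Lebesgue space carries a Borel function \<open>c : X \<rightarrow> \<real>\<close> with a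
  measurable left inverse \<open>d\<close> almost everywhere, so up to null sets a point \<open>x\<close> is the
  sequence of the answers to the countably many questions \<open>c x \<le> q\<close>, \<open>q\<close> rational, and
  \<open>\<tau>\<close> is determined by the joint law of the answers for \<open>x\<close> and for \<open>\<tau> x\<close>: this law lives on
  the graph of a Borel function.  It therefore suffices to find a cycle \<open>(Y, T)\<close>, with events on it,
  such that the answers at \<open>y\<close> and at \<open>T y\<close> have that joint law under the Loeb measure.
  
  Finite approximations (\<open>cyclic_pseudo_orbit\<close>).  Sample \<open>N\<close> points of \<open>X\<close> whose empirical
  distribution is close to \<open>\<nu>\<close> on a finite family of sets, follow each of them for \<open>L\<close> steps,
  and concatenate the \<open>N\<close> orbit pieces to a closed cycle of length \<open>N * L\<close>.  As \<open>\<tau>\<close> preserves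
  \<open>\<nu>\<close>, every one of the \<open>L\<close> columns has nearly the right statistics; the transition from a
  position to the next is an honest application of \<open>\<tau>\<close> except at the \<open>N\<close> seams, a
  proportion \<open>1 / L\<close> of the cycle.  Hence the frequencies along the cycle converge to the
  joint probabilities for \<open>(x, \<tau> x)\<close> as the family of sets and \<open>L\<close> grow.
  
  Passage to the limit (\<open>loeb_star_set\<close>).  The \<open>n\<close>-th cycle is identified with \<open>{0, \<dots>, m n - 1}\<close>;
  evaluating this sequence of cycles at an infinite hypernatural index turns them into one
  hyperfinite cycle, and a frequency with limit \<open>r\<close> becomes an internal set of Loeb
  measure exactly \<open>r\<close>.  Two measures on sequences of answers agree if they agree on the events that
  all questions in a given finite set are answered yes (\<open>incidence_eqI\<close>), so the law on \<open>Y\<close> is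
  the law on \<open>X\<close>.  Decoding with \<open>d\<close> gives \<open>\<psi>\<close>.
  
  The Loeb measure has to be shown to exist first: internal sets are sections of extended
  relations, their cardinality is obtained by transfer of the counting relation, and the
  continuity that Caratheodory's theorem asks for is \<open>\<aleph>\<^sub>1\<close>-saturation: a decreasing
  sequence of internal sets with empty intersection is eventually empty.
\<close>

section \<open>Transfer of valid formulas\<close>

abbreviation Imp :: "'u formula \<Rightarrow> 'u formula \<Rightarrow> 'u formula" where
  "Imp \<phi> \<theta> \<equiv> Neg (Conj \<phi> (Neg \<theta>))"

abbreviation All :: "nat \<Rightarrow> 'u formula \<Rightarrow> 'u formula" where
  "All x \<phi> \<equiv> Neg (Exists x (Neg \<phi>))"

text \<open>
  A formula has finitely many variables, so finitely many universal quantifiers close it.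
\<close>

lemma holds_local:
  "\<exists>k. \<forall>e e'. (\<forall>x<k. e x = e' x) \<longrightarrow> holds I \<phi> e = holds I \<phi> e'"
proof (induction \<phi>)
  case (Rel R xs)
  have "holds I (Rel R xs) e = holds I (Rel R xs) e'"
    if eq: "\<forall>x<Suc (Max (set xs)). e x = e' x" for e e'
  proof -
    have "e x = e' x" if "x \<in> set xs" for x
      using eq that by (meson List.finite_set Max_ge le_imp_less_Suc)
    then have "map e xs = map e' xs" by (rule map_cong[OF refl])
    then show ?thesis unfolding holds.simps by (rule arg_cong)
  qed
  then show ?case by blast
next
  case (Equal x y)
  show ?case by (rule exI[of _ "Suc (max x y)"]) (simp add: less_Suc_eq_le)
next
  case (Neg \<phi>)
  then obtain k where "\<And>e e'. \<forall>x<k. e x = e' x \<Longrightarrow> holds I \<phi> e = holds I \<phi> e'" by blast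
  then show ?case unfolding holds.simps by blast
next
  case (Conj \<phi> \<theta>)
  then obtain k l where k: "\<And>e e'. \<forall>x<k. e x = e' x \<Longrightarrow> holds I \<phi> e = holds I \<phi> e'"
    and l: "\<And>e e'. \<forall>x<l. e x = e' x \<Longrightarrow> holds I \<theta> e = holds I \<theta> e'" by blast
  have "holds I (Conj \<phi> \<theta>) e = holds I (Conj \<phi> \<theta>) e'"
    if "\<forall>x<max k l. e x = e' x" for e e'
    using that k[of e e'] l[of e e'] by simp
  then show ?case by blast
next
  case (Exists y \<phi>)
  then obtain k where k: "\<And>e e'. \<forall>x<k. e x = e' x \<Longrightarrow> holds I \<phi> e = holds I \<phi> e'" by blast
  have "holds I (Exists y \<phi>) e = holds I (Exists y \<phi>) e'" if "\<forall>x<k. e x = e' x" for e e'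
  proof -
    have "holds I \<phi> (e(y := a)) = holds I \<phi> (e'(y := a))" for a
      by (rule k) (simp add: that)
    then show ?thesis by simp
  qed
  then show ?case by blast
qed

lemma holds_foldr_All:
  "holds I (foldr All xs \<phi>) e \<longleftrightarrow> (\<forall>e'. (\<forall>x. x \<notin> set xs \<longrightarrow> e' x = e x) \<longrightarrow> holds I \<phi> e')"
proof (induction xs arbitrary: e)
  case Nil
  have "e' = e" if "\<forall>x. e' x = e x" for e' using that by blast
  then show ?case by auto
next
  case (Cons y xs)
  have "(\<forall>x. x \<notin> set (y # xs) \<longrightarrow> e' x = e x) \<longleftrightarrow>
      (\<exists>a. \<forall>x. x \<notin> set xs \<longrightarrow> e' x = (e(y := a)) x)" for e'
    by (rule iffI, rule exI[of _ "e' y"]) auto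
  then show ?case unfolding foldr.simps o_apply holds.simps Cons.IH by blast
qed

text \<open>
  The Transfer Principle speaks about standard values of the free variables only.  Closing a formula
  universally before the transfer lets the variables of a valid formula take nonstandard values
  afterwards.  Concrete statements are transferred by writing them as formulas:
  simplification with the equations of \<^const>\<open>holds\<close> then reads off both interpretations.
\<close>

theorem transfer_valid:
  assumes "transfer_principle U" and valid: "\<And>e. holds (\<lambda>R. R) \<phi> e"
  shows "holds (star U) \<phi> e"
proof -
  obtain k where k: "\<And>e e'. \<forall>x<k. e x = e' x \<Longrightarrow> holds (star U) \<phi> e = holds (star U) \<phi> e'"
    using holds_local[of "star U" \<phi>] by auto
  let ?d = "\<lambda>_ :: nat. undefined"
  have "holds (\<lambda>R. R) (foldr All [0..<k] \<phi>) ?d"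
    unfolding holds_foldr_All using valid by blast
  then have "holds (star U) (foldr All [0..<k] \<phi>) (emb U \<circ> ?d)"
    using assms(1) unfolding transfer_principle_def by blast
  then have "\<forall>e'. (\<forall>x. x \<notin> set [0..<k] \<longrightarrow> e' x = (emb U \<circ> ?d) x) \<longrightarrow> holds (star U) \<phi> e'"
    unfolding holds_foldr_All .
  from spec[OF this, of "\<lambda>x. if x < k then e x else emb U undefined"]
  have "holds (star U) \<phi> (\<lambda>x. if x < k then e x else emb U undefined)" by simp
  then show ?thesis using k[of e "\<lambda>x. if x < k then e x else emb U undefined"] by simp
qed

locale nonstandard =
  fixes U :: "('u, 'v) ns_universe"
  assumes universe: "nonstandard_universe U"
begin

lemma num_eq_iff [simp]: "num U i = num U j \<longleftrightarrow> i = j"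
  using universe unfolding nonstandard_universe_def by (auto dest: injD)

lemmas transfer = transfer_valid[OF universe[unfolded nonstandard_universe_def,
      THEN conjunct2, THEN conjunct1]]

lemma transfer_standard: "map (emb U) us \<in> star U R \<longleftrightarrow> us \<in> R"
proof -
  have "holds (\<lambda>R. R) (Rel R [0..<length us]) (\<lambda>i. us ! i) \<longleftrightarrow>
      holds (star U) (Rel R [0..<length us]) (emb U \<circ> (\<lambda>i. us ! i))"
    using universe unfolding nonstandard_universe_def transfer_principle_def by blast
  moreover have "map (emb U \<circ> (\<lambda>i. us ! i)) [0..<length us] = map (emb U) us"
    by (rule nth_equalityI) simp_all
  ultimately show ?thesis by (simp add: map_nth)
qed

text \<open>
  Internal sets depend on parameter lists of arbitrary length.  In the formulas below the variables
  from \<open>10\<close> on are reserved for such a list; the smaller ones serve as ordinary variables.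
\<close>

definition params :: "'w list \<Rightarrow> nat \<Rightarrow> 'w" where
  "params ps i = ps ! (i - 10)"

lemma map_params [simp]: "map (params ps) [10..<10 + length ps] = ps"
  by (rule nth_equalityI) (simp_all add: params_def)

lemma map_params_append [simp]:
  "map (params (ps @ qs)) [10..<10 + length ps] = ps"
  "map (params (ps @ qs)) [10 + length ps..<10 + length ps + length qs] = qs"
  by (rule nth_equalityI; simp add: params_def nth_append)+

text \<open>
  On relations of mixed arity the extension is still a homomorphism of Boolean algebras, because
  transfer can be applied for each length of the tuple separately.
\<close>

lemma star_Int [simp]: "star U (R \<inter> S) = star U R \<inter> star U S"
proof -
  have "vs \<in> star U (R \<inter> S) \<longleftrightarrow> vs \<in> star U R \<and> vs \<in> star U S" for vs
    using transfer[of "Conj (Imp (Rel (R \<inter> S) [10..<10 + length vs])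
         (Conj (Rel R [10..<10 + length vs]) (Rel S [10..<10 + length vs])))
       (Imp (Conj (Rel R [10..<10 + length vs]) (Rel S [10..<10 + length vs]))
         (Rel (R \<inter> S) [10..<10 + length vs]))" "params vs"]
    by auto
  then show ?thesis by blast
qed

lemma star_Compl [simp]: "star U (- R) = - star U R"
proof -
  have "vs \<in> star U (- R) \<longleftrightarrow> vs \<notin> star U R" for vs
    using transfer[of "Conj (Imp (Rel (- R) [10..<10 + length vs])
         (Neg (Rel R [10..<10 + length vs])))
       (Imp (Neg (Rel R [10..<10 + length vs])) (Rel (- R) [10..<10 + length vs]))" "params vs"]
    by auto
  then show ?thesis by blast
qed

lemma star_Diff [simp]: "star U (R - S) = star U R - star U S"
  unfolding Diff_eq by simp

lemma star_Un [simp]: "star U (R \<union> S) = star U R \<union> star U S"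
  using star_Compl[of "- R \<inter> - S"] by simp

lemma star_empty [simp]: "star U {} = {}"
  using star_Diff[of "{}" "{}"] by simp

lemma star_mono: "R \<subseteq> S \<Longrightarrow> star U R \<subseteq> star U S"
  by (metis Int_absorb2 inf.orderI inf_commute star_Int)

section \<open>Internal sets and their cardinalities\<close>

text \<open>
  The relations behind \<^const>\<open>hnat\<close> and \<^const>\<open>hless\<close> are constants with rules for membership
  of standard tuples only, so that simplification evaluates them in the standard interpretation and
  leaves their extensions alone.
\<close>

definition nat_rel :: "'u list set" where
  "nat_rel = {[num U n] |n. True}"

definition less_rel :: "'u list set" where
  "less_rel = {[num U i, num U j] |i j. i < j}"

lemma in_nat_rel [simp]: "[x] \<in> nat_rel \<longleftrightarrow> (\<exists>n. x = num U n)"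
  by (simp add: nat_rel_def)

lemma in_less_rel [simp]: "[x, y] \<in> less_rel \<longleftrightarrow> (\<exists>i j. x = num U i \<and> y = num U j \<and> i < j)"
  by (auto simp: less_rel_def)

lemma in_hnat: "[k] \<in> star U nat_rel \<longleftrightarrow> k \<in> hnat U"
  by (simp add: hnat_def nat_rel_def)

lemma in_hless: "[k, m] \<in> star U less_rel \<longleftrightarrow> hless U k m"
  by (simp add: hless_def less_rel_def)

lemma hless_hnat:
  assumes "hless U k m"
  shows "k \<in> hnat U" "m \<in> hnat U"
proof -
  have "holds (star U) (Imp (Rel less_rel [0, 1]) (Conj (Rel nat_rel [0]) (Rel nat_rel [1])))
      ((\<lambda>_. m)(0 := k, 1 := m))"
    by (rule transfer) auto
  then show "k \<in> hnat U" "m \<in> hnat U" using assms by (auto simp: in_hnat in_hless)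
qed

lemma hless_linear:
  assumes "k \<in> hnat U" "m \<in> hnat U"
  shows "hless U k m \<or> k = m \<or> hless U m k"
proof -
  have "holds (star U)
      (Imp (Conj (Rel nat_rel [0]) (Rel nat_rel [1]))
        (Imp (Neg (Rel less_rel [0, 1])) (Imp (Neg (Equal 0 1)) (Rel less_rel [1, 0]))))
      ((\<lambda>_. m)(0 := k, 1 := m))"
    by (rule transfer) auto
  then show ?thesis using assms by (auto simp: in_hnat in_hless)
qed

lemma hless_trans:
  assumes "hless U k l" "hless U l m"
  shows "hless U k m"
proof -
  have "holds (star U)
      (Imp (Conj (Rel less_rel [0, 1]) (Rel less_rel [1, 2]))
        (Rel less_rel [0, 2]))
      ((\<lambda>_. m)(0 := k, 1 := l))"
    by (rule transfer) auto
  then show ?thesis using assms by (auto simp: in_hless)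
qed

lemma hbelow_eq: "hbelow U m = {k. hless U k m}"
  using hless_hnat by (auto simp: hbelow_def)

lemma standard_hnat: "emb U (num U n) \<in> hnat U"
  using transfer_standard[of "[num U n]" nat_rel] by (simp add: in_hnat)

lemma standard_hless: "hless U (emb U (num U i)) (emb U (num U j)) \<longleftrightarrow> i < j"
  using transfer_standard[of "[num U i, num U j]" less_rel] by (simp add: in_hless)

definition slice :: "'u list set \<Rightarrow> 'v list \<Rightarrow> 'v set" where
  "slice E ps = {x. x # ps \<in> star U E}"

lemma internal_setI: "internal_set U (slice E ps)"
  unfolding internal_set_def slice_def by blast

lemma slice_Int: "slice (E \<inter> F) ps = slice E ps \<inter> slice F ps"
  and slice_Un: "slice (E \<union> F) ps = slice E ps \<union> slice F ps"
  and slice_Diff: "slice (E - F) ps = slice E ps - slice F ps"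
  by (auto simp: slice_def)

text \<open>
  Two internal sets can be given the same parameter list, each ignoring the part that belongs to the
  other.  With common parameters, Boolean operations on internal sets are Boolean operations on
  standard relations.
\<close>

lemma slice_append_right:
  "slice E ps = slice {x # us @ vs |x us vs. length us = length ps \<and> x # us \<in> E} (ps @ qs)"
    (is "_ = slice ?E' _")
proof -
  let ?p = "[10..<10 + length ps]"
  let ?q = "[10 + length ps..<10 + length ps + length qs]"
  have "x # ps \<in> star U E \<longleftrightarrow> x # ps @ qs \<in> star U ?E'" for x
  proof -
    have "holds (star U)
        (Conj (Imp (Rel E (0 # ?p)) (Rel ?E' (0 # ?p @ ?q)))
          (Imp (Rel ?E' (0 # ?p @ ?q)) (Rel E (0 # ?p))))
        ((params (ps @ qs))(0 := x))"
      by (rule transfer) auto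
    then show ?thesis by auto
  qed
  then show ?thesis by (simp add: slice_def)
qed

lemma slice_append_left:
  "slice E qs = slice {x # us @ vs |x us vs. length us = length ps \<and> x # vs \<in> E} (ps @ qs)"
    (is "_ = slice ?E' _")
proof -
  let ?p = "[10..<10 + length ps]"
  let ?q = "[10 + length ps..<10 + length ps + length qs]"
  have "x # qs \<in> star U E \<longleftrightarrow> x # ps @ qs \<in> star U ?E'" for x
  proof -
    have "holds (star U)
        (Conj (Imp (Rel E (0 # ?q)) (Rel ?E' (0 # ?p @ ?q)))
          (Imp (Rel ?E' (0 # ?p @ ?q)) (Rel E (0 # ?q))))
        ((params (ps @ qs))(0 := x))"
      by (rule transfer) auto
    then show ?thesis by auto
  qed
  then show ?thesis by (simp add: slice_def)
qed

lemma internal_common_parameters: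
  assumes "internal_set U A" "internal_set U B"
  obtains E F ps where "A = slice E ps" "B = slice F ps"
proof -
  obtain E ps F qs where "A = slice E ps" "B = slice F qs"
    using assms unfolding internal_set_def slice_def by blast
  then show thesis
    using that[OF trans[OF _ slice_append_right[of E ps qs]] trans[OF _ slice_append_left[of F qs ps]]]
    by blast
qed

lemma internal_Int: "internal_set U A \<Longrightarrow> internal_set U B \<Longrightarrow> internal_set U (A \<inter> B)"
  and internal_Un: "internal_set U A \<Longrightarrow> internal_set U B \<Longrightarrow> internal_set U (A \<union> B)"
  and internal_Diff: "internal_set U A \<Longrightarrow> internal_set U B \<Longrightarrow> internal_set U (A - B)"
  by (metis internal_common_parameters internal_setI slice_Int slice_Un slice_Diff)+

lemma internal_empty: "internal_set U {}"
  using internal_setI[of "{}" "[]"] by (simp add: slice_def)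

lemma hbelow_slice: "hbelow U m = slice less_rel [m]"
  by (auto simp: hbelow_eq slice_def in_hless)

lemma internal_hbelow: "internal_set U (hbelow U m)"
  unfolding hbelow_slice by (rule internal_setI)

definition members :: "'u list set \<Rightarrow> nat \<Rightarrow> 'u list \<Rightarrow> nat set" where
  "members E m us = {i. i < m \<and> num U i # us \<in> E}"

lemma finite_members [simp]: "finite (members E m us)"
  by (simp add: members_def)

text \<open>
  Every section of \<open>E\<close> below \<open>m\<close> has a cardinality and an increasing enumeration.  As relations
  that are uniform in \<open>m\<close> and in the parameters they extend to the nonstandard universe, where they
  provide the internal cardinality of every internal subset of an initial segment, together with an
  internal bijection that witnesses it.
\<close>

definition count_rel :: "'u list set \<Rightarrow> 'u list set" where
  "count_rel E = {num U (card (members E m us)) # num U m # us |m us. True}"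

definition enum_rel :: "'u list set \<Rightarrow> 'u list set" where
  "enum_rel E = {num U a # num U (sorted_list_of_set (members E m us) ! a) # num U m # us |a m us.
     a < card (members E m us)}"

lemma in_count_rel [simp]:
  "j # m # us \<in> count_rel E \<longleftrightarrow> (\<exists>i. m = num U i \<and> j = num U (card (members E i us)))"
  by (auto simp: count_rel_def)

lemma in_enum_rel [simp]:
  "a # x # m # us \<in> enum_rel E \<longleftrightarrow> (\<exists>b i. m = num U i \<and> a = num U b \<and>
     b < card (members E i us) \<and> x = num U (sorted_list_of_set (members E i us) ! b))"
  by (auto simp: enum_rel_def)

lemma count_exists:
  assumes "m \<in> hnat U"
  obtains j where "j \<in> hnat U" "j # m # ps \<in> star U (count_rel E)" "\<not> hless U m j"
proof -
  let ?p = "[10..<10 + length ps]"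
  have "card (members E i us) \<le> i" for i us
    using card_mono[of "{..<i}" "members E i us"] by (auto simp: members_def)
  then have le: "\<not> i < card (members E i us)" for i us by (simp add: not_less)
  have "holds (star U) (Imp (Rel nat_rel [0]) (Exists 1 (Conj (Rel nat_rel [1])
      (Conj (Rel (count_rel E) (1 # 0 # ?p)) (Neg (Rel less_rel [0, 1])))))) ((params ps)(0 := m))"
    by (rule transfer) (use le in auto)
  then show thesis using assms that by (auto simp: in_hnat in_hless)
qed

lemma has_hcard_count:
  assumes m: "m \<in> hnat U" and j: "j # m # ps \<in> star U (count_rel E)"
  shows "has_hcard U (hbelow U m \<inter> slice E ps) j"
proof -
  let ?p = "[10..<10 + length ps]"
  let ?G = "\<lambda>a x. a # x # m # ps \<in> star U (enum_rel E)"
  let ?l = "\<lambda>i us. sorted_list_of_set (members E i us)"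
  let ?e = "\<lambda>a x y. (params ps)(0 := m, 1 := j, 2 := a, 3 := x, 4 := y)"
  have nth: "?l i us ! a \<in> members E i us" if "a < card (members E i us)" for a i us
    using that by (metis finite_members length_sorted_list_of_set nth_mem set_sorted_list_of_set)
  have nth_inj: "a = b" if "?l i us ! a = ?l i us ! b" "a < card (members E i us)" "b < card (members E i us)"
    for a b i us
    using that by (metis distinct_sorted_list_of_set length_sorted_list_of_set nth_eq_iff_index_eq)
  have nth_ex: "\<exists>a<card (members E i us). x = ?l i us ! a" if "x \<in> members E i us" for x i us
    using that by (metis finite_members in_set_conv_nth length_sorted_list_of_set set_sorted_list_of_set)
  have jn: "j \<in> hnat U"
  proof -
    have "holds (star U) (Imp (Rel (count_rel E) (1 # 0 # ?p)) (Rel nat_rel [1]))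
        (?e j j j)"
      by (rule transfer) auto
    then show ?thesis using j by (auto simp: in_hnat)
  qed
  have total: "\<exists>x. ?G a x" if "hless U a j" for a
  proof -
    have "holds (star U)
        (Imp (Conj (Rel (count_rel E) (1 # 0 # ?p)) (Rel less_rel [2, 1]))
          (Exists 3 (Rel (enum_rel E) (2 # 3 # 0 # ?p))))
        (?e a j j)"
      by (rule transfer) auto
    then show ?thesis using that j by (auto simp: in_hless)
  qed
  have dom: "hless U a j" if "?G a x" for a x
  proof -
    have "holds (star U)
        (Imp (Conj (Rel (count_rel E) (1 # 0 # ?p)) (Rel (enum_rel E) (2 # 3 # 0 # ?p)))
          (Rel less_rel [2, 1]))
        (?e a x j)"
      by (rule transfer) auto
    then show ?thesis using that j by (auto simp: in_hless)
  qed
  have functional: "x = y" if "?G a x" "?G a y" for a x y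
  proof -
    have "holds (star U)
        (Imp (Conj (Rel (enum_rel E) (2 # 3 # 0 # ?p)) (Rel (enum_rel E) (2 # 4 # 0 # ?p)))
          (Equal 3 4))
        (?e a x y)"
      by (rule transfer) auto
    then show ?thesis using that by auto
  qed
  have inj: "a = b" if "?G a x" "?G b x" for a b x
  proof -
    have "holds (star U)
        (Imp (Conj (Rel (enum_rel E) (2 # 3 # 0 # ?p)) (Rel (enum_rel E) (4 # 3 # 0 # ?p)))
          (Equal 2 4))
        (?e a x b)"
      by (rule transfer) (auto dest: nth_inj)
    then show ?thesis using that by auto
  qed
  have into: "hless U x m \<and> x # ps \<in> star U E" if "?G a x" for a x
  proof -
    have "holds (star U)
        (Imp (Rel (enum_rel E) (2 # 3 # 0 # ?p))
          (Conj (Rel less_rel [3, 0]) (Rel E (3 # ?p))))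
        (?e a x j)"
      by (rule transfer) (use nth in \<open>auto simp: members_def\<close>)
    then show ?thesis using that by (auto simp: in_hless members_def)
  qed
  have onto: "\<exists>a. ?G a x" if "hless U x m" "x # ps \<in> star U E" for x
  proof -
    have "holds (star U)
        (Imp (Conj (Rel less_rel [3, 0]) (Rel E (3 # ?p)))
          (Exists 2 (Rel (enum_rel E) (2 # 3 # 0 # ?p))))
        (?e j x j)"
      by (rule transfer) (use nth_ex in \<open>fastforce simp: members_def\<close>)
    then show ?thesis using that by (fastforce simp: in_hless members_def)
  qed
  define f where "f = (\<lambda>a. THE x. ?G a x)"
  have f: "f a = x" if "?G a x" for a x
    unfolding f_def using that functional by blast
  have graph: "{(a, f a) |a. a \<in> hbelow U j} = {(a, x). ?G a x}"
    using f total dom by (fastforce simp: hbelow_eq)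
  have "internal_fun_on U (hbelow U j) f"
    unfolding internal_fun_on_def internal_rel_def graph by blast
  moreover have "bij_betw f (hbelow U j) (hbelow U m \<inter> slice E ps)"
    unfolding bij_betw_def inj_on_def
  proof (intro conjI ballI impI equalityI subsetI)
    fix a b assume "a \<in> hbelow U j" "b \<in> hbelow U j" "f a = f b"
    then show "a = b" using f total inj by (metis hbelow_eq mem_Collect_eq)
  next
    fix x assume "x \<in> f ` hbelow U j"
    then show "x \<in> hbelow U m \<inter> slice E ps"
      using f total into by (fastforce simp: hbelow_eq slice_def)
  next
    fix x assume "x \<in> hbelow U m \<inter> slice E ps"
    then show "x \<in> f ` hbelow U j"
      using f onto dom by (fastforce simp: hbelow_eq slice_def)
  qed
  ultimately show ?thesis using jn unfolding has_hcard_def by blast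
qed

text \<open>
  Internal cardinalities are unique by the internal pigeonhole principle: internal enumerations of
  the same set by \<open>m\<close> and by \<open>n > m\<close> numbers would repeat a value.  The transferred formula compares
  the two enumerations through their graphs, which have parameters of their own.
\<close>

lemma has_hcard_not_hless:
  assumes "has_hcard U A m" "has_hcard U A n"
  shows "\<not> hless U m n"
proof
  assume mn: "hless U m n"
  obtain f g where f: "internal_fun_on U (hbelow U m) f" "bij_betw f (hbelow U m) A"
    and g: "internal_fun_on U (hbelow U n) g" "bij_betw g (hbelow U n) A"
    using assms unfolding has_hcard_def by blast
  obtain E ps where E: "{(x, f x) |x. x \<in> hbelow U m} = {(x, y). x # y # ps \<in> star U E}"
    using f(1) unfolding internal_fun_on_def internal_rel_def by blast
  obtain F qs where F: "{(x, g x) |x. x \<in> hbelow U n} = {(x, y). x # y # qs \<in> star U F}"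
    using g(1) unfolding internal_fun_on_def internal_rel_def by blast
  have fE: "x # z # ps \<in> star U E \<longleftrightarrow> hless U x m \<and> z = f x" for x z
    using E by (auto simp: hbelow_eq set_eq_iff)
  have gF: "y # z # qs \<in> star U F \<longleftrightarrow> hless U y n \<and> z = g y" for y z
    using F by (auto simp: hbelow_eq set_eq_iff)
  let ?p = "[10..<10 + length ps]"
  let ?q = "[10 + length ps..<10 + length ps + length qs]"
  let ?P = "\<lambda>x y z. Conj (Rel E (x # z # ?p)) (Rel F (y # z # ?q))"
  \<comment> \<open>Variables 0 and 1 are the sizes m and n; if every y below n shares a value with some x below m,
    then some x shares values with two different y.\<close>
  let ?\<phi> = "Imp (Conj (Rel less_rel [0, 1]) (All 2 (Imp (Rel less_rel [2, 1])
        (Exists 3 (Conj (Rel less_rel [3, 0]) (Exists 4 (?P 3 2 4)))))))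
      (Exists 2 (Exists 3 (Exists 4 (Exists 5 (Exists 6 (Conj (Neg (Equal 2 3))
        (Conj (?P 4 2 5) (?P 4 3 6))))))))"
  have "holds (\<lambda>R. R) ?\<phi> e" for e
  proof -
    let ?us = "map e ?p" and ?vs = "map e ?q"
    have pigeon: "\<exists>y y' x z z'. y \<noteq> y' \<and> (x # z # ?us \<in> E \<and> y # z # ?vs \<in> F) \<and>
        x # z' # ?us \<in> E \<and> y' # z' # ?vs \<in> F"
      if ij: "i < j" and ex: "\<And>y. y < j \<Longrightarrow> \<exists>x<i. \<exists>z. num U x # z # ?us \<in> E \<and> num U y # z # ?vs \<in> F"
      for i j
    proof -
      obtain h where h: "\<And>y. y < j \<Longrightarrow> h y < i \<and>
          (\<exists>z. num U (h y) # z # ?us \<in> E \<and> num U y # z # ?vs \<in> F)"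
        using ex by metis
      then have "h ` {..<j} \<subseteq> {..<i}" by auto
      then have "\<not> inj_on h {..<j}"
        using ij card_inj_on_le[of h "{..<j}" "{..<i}"] by auto
      then obtain y y' where y: "y < j" "y' < j" "y \<noteq> y'" "h y = h y'"
        by (auto simp: inj_on_def)
      obtain z z' where z: "num U (h y) # z # ?us \<in> E" "num U y # z # ?vs \<in> F"
        "num U (h y') # z' # ?us \<in> E" "num U y' # z' # ?vs \<in> F"
        using h[OF y(1)] h[OF y(2)] by blast
      show ?thesis
        using z y(3) unfolding y(4)
        by (intro exI[of _ "num U y"] exI[of _ "num U y'"] exI[of _ "num U (h y')"]
            exI[of _ z] exI[of _ z']) simp
    qed
    have "\<exists>y y' x z z'. y \<noteq> y' \<and> (x # z # ?us \<in> E \<and> y # z # ?vs \<in> F) \<and>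
        x # z' # ?us \<in> E \<and> y' # z' # ?vs \<in> F"
      if less: "[e 0, e 1] \<in> less_rel" and ex: "\<forall>y. [y, e 1] \<in> less_rel \<longrightarrow>
        (\<exists>x. [x, e 0] \<in> less_rel \<and> (\<exists>z. x # z # ?us \<in> E \<and> y # z # ?vs \<in> F))"
    proof -
      obtain i j where ij: "e 0 = num U i" "e 1 = num U j" "i < j"
        using less unfolding in_less_rel by blast
      have "\<exists>x<i. \<exists>z. num U x # z # ?us \<in> E \<and> num U y # z # ?vs \<in> F" if "y < j" for y
      proof -
        have "[num U y, e 1] \<in> less_rel" using that ij by simp
        then obtain x z where "[x, e 0] \<in> less_rel" "x # z # ?us \<in> E" "num U y # z # ?vs \<in> F"
          using ex by blast
        then show ?thesis using ij by auto
      qed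
      then show ?thesis by (rule pigeon[OF ij(3)])
    qed
    then show ?thesis by (simp del: in_less_rel) blast
  qed
  then have "holds (star U) ?\<phi> ((params (ps @ qs))(0 := m, 1 := n))" by (rule transfer)
  moreover have "\<exists>x. hless U x m \<and> (\<exists>z. x # z # ps \<in> star U E \<and> y # z # qs \<in> star U F)"
    if "hless U y n" for y
  proof -
    have "g y \<in> f ` hbelow U m"
      using that f(2) g(2) by (auto simp: bij_betw_def hbelow_eq)
    then show ?thesis using that by (auto simp: fE gF hbelow_eq)
  qed
  ultimately have "\<exists>y y' x z z'. y \<noteq> y' \<and> (x # z # ps \<in> star U E \<and> y # z # qs \<in> star U F) \<and>
      x # z' # ps \<in> star U E \<and> y' # z' # qs \<in> star U F"
    using mn by (simp add: in_hless) blast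
  then obtain y y' where "y \<noteq> y'" "hless U y n" "hless U y' n" "g y = g y'"
    unfolding fE gF by metis
  then show False using g(2) by (auto simp: bij_betw_def inj_on_def hbelow_eq)
qed

lemma hcard_eqI:
  assumes "has_hcard U A m"
  shows "hcard U A = m"
  unfolding hcard_def
proof (rule the_equality)
  show "has_hcard U A m" by (rule assms)
  fix n assume "has_hcard U A n"
  then show "n = m"
    using assms has_hcard_not_hless hless_linear unfolding has_hcard_def by metis
qed

lemma internal_fun_on_id: "internal_fun_on U (hbelow U m) id"
proof -
  let ?E = "{[num U i, num U i, num U j] |i j. i < j}"
  have "[x, y, m] \<in> star U ?E \<longleftrightarrow> y = x \<and> hless U x m" for x y
  proof -
    have "holds (star U)
        (Conj (Imp (Rel ?E [0, 1, 2]) (Conj (Equal 1 0) (Rel less_rel [0, 2])))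
          (Imp (Conj (Equal 1 0) (Rel less_rel [0, 2])) (Rel ?E [0, 1, 2])))
        ((\<lambda>_. m)(0 := x, 1 := y))"
      by (rule transfer) auto
    then show ?thesis by (auto simp: in_hless)
  qed
  then have "{(x, id x) |x. x \<in> hbelow U m} = {(x, y). x # y # [m] \<in> star U ?E}"
    by (auto simp: hbelow_eq)
  then show ?thesis
    unfolding internal_fun_on_def internal_rel_def by blast
qed

lemma has_hcard_hbelow: "m \<in> hnat U \<Longrightarrow> has_hcard U (hbelow U m) m"
  unfolding has_hcard_def using internal_fun_on_id bij_betw_id by blast

text \<open>
  The relation that defines \<^const>\<open>st_quotient\<close>.  Both uniqueness and existence of standard parts
  of quotients come from Boolean relations between such standard sets of pairs.
\<close>

definition near_rel :: "real \<Rightarrow> real \<Rightarrow> 'u list set" where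
  "near_rel r \<epsilon> = {[num U i, num U j] |i j. \<bar>real i / real j - r\<bar> < \<epsilon>}"

lemma quotient_unique:
  assumes "\<And>\<epsilon>. \<epsilon> > 0 \<Longrightarrow> [b, m] \<in> star U (near_rel r \<epsilon>)"
    and "\<And>\<epsilon>. \<epsilon> > 0 \<Longrightarrow> [b, m] \<in> star U (near_rel s \<epsilon>)"
  shows "r = s"
proof (rule ccontr)
  assume "r \<noteq> s"
  then have pos: "\<bar>r - s\<bar> / 2 > 0" by simp
  have apart: False if "\<bar>x - r\<bar> * 2 < \<bar>r - s\<bar>" "\<bar>x - s\<bar> * 2 < \<bar>r - s\<bar>" for x :: real
  proof -
    have "\<bar>r - s\<bar> \<le> \<bar>x - s\<bar> + \<bar>x - r\<bar>" using abs_triangle_ineq4[of "x - s" "x - r"] by simp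
    moreover have False if "d \<le> a + b" "b * 2 < d" "a * 2 < d" for a b d :: real
      using that by linarith
    ultimately show False using that by blast
  qed
  have "near_rel r (\<bar>r - s\<bar> / 2) \<inter> near_rel s (\<bar>r - s\<bar> / 2) = {}"
    unfolding near_rel_def by (auto dest: apart)
  then have "star U (near_rel r (\<bar>r - s\<bar> / 2)) \<inter> star U (near_rel s (\<bar>r - s\<bar> / 2)) = {}"
    by (metis star_Int star_empty)
  then show False using assms pos by blast
qed

lemma st_quotient_eqI:
  assumes "\<And>\<epsilon>. \<epsilon> > 0 \<Longrightarrow> [b, m] \<in> star U (near_rel r \<epsilon>)"
  shows "st_quotient U b m = r"
  unfolding st_quotient_def near_rel_def[symmetric]
  using assms quotient_unique by (intro the_equality) blast+

text \<open>
  The quotient of \<open>b \<le> m\<close> determines a bounded Dedekind cut in the standard reals; its supremum is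
  the standard part.
\<close>

lemma quotient_exists:
  assumes "b \<in> hnat U" "m \<in> hnat U" "\<not> hless U m b"
  obtains r where "0 \<le> r" "\<And>\<epsilon>. \<epsilon> > 0 \<Longrightarrow> [b, m] \<in> star U (near_rel r \<epsilon>)"
proof -
  define ge where "ge = (\<lambda>q. {[num U i, num U j] |i j. q \<le> real i / real j})"
  let ?D = "{q. [b, m] \<in> star U (ge q)}"
  define le where "le = {[num U i, num U j] |i j. i \<le> j}"
  have in_le: "[x, y] \<in> le \<longleftrightarrow> (\<exists>i j. x = num U i \<and> y = num U j \<and> i \<le> j)" for x y
    by (auto simp: le_def)
  have "holds (star U) (Imp (Conj (Rel nat_rel [0]) (Rel nat_rel [1]))
      (Imp (Neg (Rel less_rel [1, 0])) (Rel le [0, 1]))) ((\<lambda>_. m)(0 := b))"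
    by (rule transfer) (auto simp: in_le not_less)
  then have le: "[b, m] \<in> star U le"
    using assms by (simp add: in_hnat in_hless)
  have "le \<subseteq> ge 0"
    by (auto simp: ge_def le_def)
  then have D0: "0 \<in> ?D" using le star_mono by blast
  have D1: "q \<le> 1" if "q \<in> ?D" for q
  proof (rule ccontr)
    assume "\<not> q \<le> 1"
    then have "ge q \<inter> le = {}"
      by (auto simp: ge_def le_def) (smt (verit) divide_le_eq_1 of_nat_0_le_iff of_nat_mono)
    then have "star U (ge q) \<inter> star U le = {}"
      by (metis star_Int star_empty)
    then show False using that le by blast
  qed
  have bdd: "bdd_above ?D" using D1 by (auto simp: bdd_above_def)
  let ?r = "Sup ?D"
  have "[b, m] \<in> star U (near_rel ?r \<epsilon>)" if "\<epsilon> > 0" for \<epsilon>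
  proof -
    obtain q where q: "q \<in> ?D" "?r - \<epsilon> < q"
      using less_cSupD[of ?D "?r - \<epsilon>"] D0 \<open>\<epsilon> > 0\<close> by auto
    have "?r + \<epsilon> / 2 \<notin> ?D"
      using cSup_upper[OF _ bdd, of "?r + \<epsilon> / 2"] \<open>\<epsilon> > 0\<close> by auto
    then have "[b, m] \<in> star U (le \<inter> ge q \<inter> - ge (?r + \<epsilon> / 2))"
      using le q(1) by simp
    moreover have "le \<inter> ge q \<inter> - ge (?r + \<epsilon> / 2) \<subseteq> near_rel ?r \<epsilon>"
      using q(2) \<open>\<epsilon> > 0\<close> by (auto simp: le_def ge_def near_rel_def abs_less_iff) 
    ultimately show ?thesis using star_mono by blast
  qed
  moreover have "0 \<le> ?r" by (rule cSup_upper[OF D0 bdd])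
  ultimately show thesis using that by blast
qed

section \<open>The Loeb measure on a hyperfinite initial segment\<close>

definition loeb_mass :: "'v \<Rightarrow> 'v set \<Rightarrow> real" where
  "loeb_mass M B = st_quotient U (hcard U B) (hcard U (hbelow U M))"

lemma in_near_rel [simp]: "[x, y] \<in> near_rel r \<epsilon> \<longleftrightarrow>
    (\<exists>i j. x = num U i \<and> y = num U j \<and> \<bar>real i / real j - r\<bar> < \<epsilon>)"
  by (auto simp: near_rel_def)

lemma loeb_mass_count:
  assumes M: "M \<in> hnat U"
  obtains j where "j # M # ps \<in> star U (count_rel E)"
    "0 \<le> loeb_mass M (hbelow U M \<inter> slice E ps)"
    "\<And>\<epsilon>. \<epsilon> > 0 \<Longrightarrow> [j, M] \<in> star U (near_rel (loeb_mass M (hbelow U M \<inter> slice E ps)) \<epsilon>)"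
proof -
  obtain j where j: "j \<in> hnat U" "j # M # ps \<in> star U (count_rel E)" "\<not> hless U M j"
    using count_exists[OF M] by blast
  obtain r where r: "0 \<le> r" "\<And>\<epsilon>. \<epsilon> > 0 \<Longrightarrow> [j, M] \<in> star U (near_rel r \<epsilon>)"
    using quotient_exists[OF j(1) M j(3)] by blast
  have "loeb_mass M (hbelow U M \<inter> slice E ps) = r"
    unfolding loeb_mass_def hcard_eqI[OF has_hcard_count[OF M j(2)]]
      hcard_eqI[OF has_hcard_hbelow[OF M]]
    by (rule st_quotient_eqI[OF r(2)])
  then show thesis using that j r by blast
qed

lemma loeb_mass_eqI:
  assumes M: "M \<in> hnat U"
    and near: "\<And>j \<epsilon>. \<epsilon> > 0 \<Longrightarrow> j # M # ps \<in> star U (count_rel E) \<Longrightarrow> [j, M] \<in> star U (near_rel r \<epsilon>)"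
  shows "loeb_mass M (hbelow U M \<inter> slice E ps) = r"
proof -
  obtain j where j: "j # M # ps \<in> star U (count_rel E)"
    "\<And>\<epsilon>. \<epsilon> > 0 \<Longrightarrow> [j, M] \<in> star U (near_rel (loeb_mass M (hbelow U M \<inter> slice E ps)) \<epsilon>)"
    using loeb_mass_count[OF M] by blast
  show ?thesis by (rule quotient_unique[OF j(2) near[OF _ j(1)]])
qed

text \<open>
  Additivity for \<open>E\<close> and \<open>F - E\<close>, which are disjoint already as standard relations, so that the
  counts add up in the standard universe.  If the three standard parts did not add up, they would
  differ by some \<open>3 * \<epsilon>\<close>, and no standard counts are that far from additive.
\<close>

lemma loeb_mass_Un_slice:
  assumes M: "M \<in> hnat U"
  shows "loeb_mass M (hbelow U M \<inter> slice (E \<union> F) ps)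
    = loeb_mass M (hbelow U M \<inter> slice E ps) + loeb_mass M (hbelow U M \<inter> slice (F - E) ps)"
    (is "?u = ?r + ?s")
proof (rule ccontr)
  assume ne: "?u \<noteq> ?r + ?s"
  define \<epsilon> where "\<epsilon> = \<bar>?u - (?r + ?s)\<bar> / 3"
  have \<epsilon>: "\<epsilon> > 0" using ne by (simp add: \<epsilon>_def)
  let ?p = "[10..<10 + length ps]"
  obtain i where i: "i # M # ps \<in> star U (count_rel E)" "[i, M] \<in> star U (near_rel ?r \<epsilon>)"
    using loeb_mass_count[OF M, of ps] \<epsilon> by blast
  obtain j where j: "j # M # ps \<in> star U (count_rel (F - E))" "[j, M] \<in> star U (near_rel ?s \<epsilon>)"
    using loeb_mass_count[OF M, of ps] \<epsilon> by blast
  obtain k where k: "k # M # ps \<in> star U (count_rel (E \<union> F))" "[k, M] \<in> star U (near_rel ?u \<epsilon>)"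
    using loeb_mass_count[OF M, of ps] \<epsilon> by blast
  have card: "card (members (E \<union> F) m us) = card (members E m us) + card (members (F - E) m us)" for m us
  proof -
    have "members (E \<union> F) m us = members E m us \<union> members (F - E) m us"
      "members E m us \<inter> members (F - E) m us = {}"
      by (auto simp: members_def)
    then show ?thesis by (simp add: card_Un_disjoint)
  qed
  have far: False if "\<bar>a / m - ?r\<bar> < \<epsilon>" "\<bar>b / m - ?s\<bar> < \<epsilon>" "\<bar>(a + b) / m - ?u\<bar> < \<epsilon>" for a b m :: real
  proof -
    have "\<bar>?u - (?r + ?s)\<bar> < 3 * \<epsilon>" using that unfolding add_divide_distrib by linarith
    then show False by (simp add: \<epsilon>_def)
  qed
  have "holds (star U) (Neg (Conj (Conj (Rel (count_rel E) (1 # 0 # ?p)) (Rel (near_rel ?r \<epsilon>) [1, 0]))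
      (Conj (Conj (Rel (count_rel (F - E)) (2 # 0 # ?p)) (Rel (near_rel ?s \<epsilon>) [2, 0]))
      (Conj (Rel (count_rel (E \<union> F)) (3 # 0 # ?p)) (Rel (near_rel ?u \<epsilon>) [3, 0])))))
    ((params ps)(0 := M, 1 := i, 2 := j, 3 := k))"
  proof (rule transfer)
    fix e :: "nat \<Rightarrow> 'u"
    show "holds (\<lambda>R. R) (Neg (Conj (Conj (Rel (count_rel E) (1 # 0 # ?p)) (Rel (near_rel ?r \<epsilon>) [1, 0]))
      (Conj (Conj (Rel (count_rel (F - E)) (2 # 0 # ?p)) (Rel (near_rel ?s \<epsilon>) [2, 0]))
      (Conj (Rel (count_rel (E \<union> F)) (3 # 0 # ?p)) (Rel (near_rel ?u \<epsilon>) [3, 0]))))) e"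
      using far by (force simp: card)
  qed
  then show False using i j k by simp
qed

lemma internal_subset_slice:
  assumes "internal_set U B" "B \<subseteq> hbelow U M"
  obtains E ps where "B = hbelow U M \<inter> slice E ps"
  using assms unfolding internal_set_def slice_def by blast

lemma loeb_mass_nonneg:
  assumes "M \<in> hnat U" "internal_set U B" "B \<subseteq> hbelow U M"
  shows "0 \<le> loeb_mass M B"
proof -
  obtain E ps where "B = hbelow U M \<inter> slice E ps"
    using internal_subset_slice[OF assms(2,3)] .
  then show ?thesis using loeb_mass_count[OF assms(1), of ps E] by blast
qed

lemma loeb_mass_Un:
  assumes M: "M \<in> hnat U" and B: "internal_set U B" "B \<subseteq> hbelow U M"
    and C: "internal_set U C" "C \<subseteq> hbelow U M" and disj: "B \<inter> C = {}"
  shows "loeb_mass M (B \<union> C) = loeb_mass M B + loeb_mass M C"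
proof -
  obtain E F ps where EF: "B = slice E ps" "C = slice F ps"
    using internal_common_parameters[OF B(1) C(1)] by blast
  have "B \<union> C = hbelow U M \<inter> slice (E \<union> F) ps" "B = hbelow U M \<inter> slice E ps"
    "C = hbelow U M \<inter> slice (F - E) ps"
    using B(2) C(2) disj unfolding EF slice_Un slice_Diff by blast+
  then show ?thesis using loeb_mass_Un_slice[OF M, of E F ps] by simp
qed

lemma loeb_mass_whole:
  assumes "M \<in> hnat U" "hless U (emb U (num U 0)) M"
  shows "loeb_mass M (hbelow U M) = 1"
proof -
  have "hcard U (hbelow U M) = M" by (rule hcard_eqI[OF has_hcard_hbelow[OF assms(1)]])
  moreover have "st_quotient U M M = 1"
  proof (rule st_quotient_eqI)
    fix \<epsilon> :: real assume \<epsilon>: "\<epsilon> > 0"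
    have "holds (star U) (Imp (Rel less_rel [0, 1]) (Rel (near_rel 1 \<epsilon>) [1, 1]))
        ((\<lambda>_. M)(0 := emb U (num U 0)))"
    proof (rule transfer)
      fix e :: "nat \<Rightarrow> 'u"
      have "[e 1, e 1] \<in> near_rel 1 \<epsilon>" if "[e 0, e 1] \<in> less_rel"
      proof -
        obtain i j where "e 1 = num U j" "i < j" using \<open>[e 0, e 1] \<in> less_rel\<close> by auto
        then show ?thesis using \<epsilon> by simp
      qed
      then show "holds (\<lambda>R. R) (Imp (Rel less_rel [0, 1]) (Rel (near_rel 1 \<epsilon>) [1, 1])) e"
        by (simp del: in_near_rel in_less_rel)
    qed
    then show "[M, M] \<in> star U (near_rel 1 \<epsilon>)" using assms(2) by (simp add: in_hless)
  qed
  ultimately show ?thesis by (simp add: loeb_mass_def)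
qed

definition internal_subsets :: "'v \<Rightarrow> 'v set set" where
  "internal_subsets M = {B. B \<subseteq> hbelow U M \<and> internal_set U B}"

lemma algebra_internal_subsets: "algebra (hbelow U M) (internal_subsets M)"
  unfolding algebra_iff_Un
  by (auto simp: internal_subsets_def internal_empty internal_Un internal_Diff internal_hbelow)

text \<open>
  Saturation in the form needed for measures: continuity at the empty set holds in the strongest
  possible way, since the sequence becomes empty after finitely many steps.
\<close>

lemma decseq_internal_empty:
  assumes int: "\<And>n. internal_set U (A n)" and dec: "decseq A" and empty: "(\<Inter>n. A n) = {}"
  obtains n where "\<And>k. k \<ge> n \<Longrightarrow> A k = {}"
proof -
  have "\<exists>n. (\<Inter>k\<le>n. A k) = {}"
    using universe int empty unfolding nonstandard_universe_def aleph1_saturated_def by blast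
  then obtain n where "(\<Inter>k\<le>n. A k) = {}" by blast
  moreover have "A n \<subseteq> (\<Inter>k\<le>n. A k)" using dec by (auto simp: decseq_def)
  ultimately have "A n = {}" by blast
  then show thesis using dec that[of n] by (auto simp: decseq_def)
qed

lemma loeb_mass_extends:
  assumes M: "M \<in> hnat U"
  obtains \<mu> where "\<And>B. B \<in> internal_subsets M \<Longrightarrow> \<mu> B = ennreal (loeb_mass M B)"
    "measure_space (hbelow U M) (sigma_sets (hbelow U M) (internal_subsets M)) \<mu>"
proof -
  interpret algebra "hbelow U M" "internal_subsets M" by (rule algebra_internal_subsets)
  let ?\<mu> = "\<lambda>B. ennreal (loeb_mass M B)"
  have add: "loeb_mass M (B \<union> C) = loeb_mass M B + loeb_mass M C" and nonneg: "0 \<le> loeb_mass M B"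
    if "B \<in> internal_subsets M" "C \<in> internal_subsets M" "B \<inter> C = {}" for B C
    using that loeb_mass_Un[OF M] loeb_mass_nonneg[OF M] by (auto simp: internal_subsets_def)
  have empty: "loeb_mass M {} = 0" using add[of "{}" "{}"] by simp
  have "\<exists>\<mu>. (\<forall>s\<in>internal_subsets M. \<mu> s = ?\<mu> s) \<and>
      measure_space (hbelow U M) (sigma_sets (hbelow U M) (internal_subsets M)) \<mu>"
  proof (rule caratheodory_empty_continuous)
    show "positive (internal_subsets M) ?\<mu>" by (simp add: positive_def empty)
    show "additive (internal_subsets M) ?\<mu>"
      unfolding additive_def
    proof (intro ballI impI)
      fix B C assume BC: "B \<in> internal_subsets M" "C \<in> internal_subsets M" "B \<inter> C = {}"
      then have "C \<inter> B = {}" by blast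
      then show "?\<mu> (B \<union> C) = ?\<mu> B + ?\<mu> C"
        using add[OF BC] nonneg[OF BC] nonneg[OF BC(2,1)] by (simp add: ennreal_plus)
    qed
    show "?\<mu> A \<noteq> \<infinity>" for A by simp
    fix A :: "nat \<Rightarrow> 'v set"
    assume A: "range A \<subseteq> internal_subsets M" "decseq A" "\<Inter> (range A) = {}"
    have "internal_set U (A n)" for n using A(1) by (auto simp: internal_subsets_def)
    then obtain n where n: "\<And>k. k \<ge> n \<Longrightarrow> A k = {}"
      using decseq_internal_empty[OF _ A(2,3)] by blast
    have "\<forall>\<^sub>F k in sequentially. ?\<mu> (A k) = 0"
      using eventually_ge_at_top[of n] by (rule eventually_mono) (simp add: n empty)
    then show "(\<lambda>i. ?\<mu> (A i)) \<longlonglongrightarrow> 0" by (rule tendsto_eventually)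
  qed
  then show thesis using that by blast
qed

text \<open>
  \<^const>\<open>extend_measure\<close> returns the zero measure when no extension exists, so the values on
  internal sets depend on the extension just constructed.
\<close>

lemma loeb_measure_hbelow:
  assumes M: "M \<in> hnat U" "hless U (emb U (num U 0)) M"
  shows prob_space_loeb: "prob_space (loeb_measure U (hbelow U M))"
    and space_loeb: "space (loeb_measure U (hbelow U M)) = hbelow U M"
    and sets_loeb: "B \<subseteq> hbelow U M \<Longrightarrow> internal_set U B \<Longrightarrow> B \<in> sets (loeb_measure U (hbelow U M))"
    and emeasure_loeb: "B \<subseteq> hbelow U M \<Longrightarrow> internal_set U B \<Longrightarrow>
      emeasure (loeb_measure U (hbelow U M)) B = ennreal (loeb_mass M B)"
proof -
  define N where "N = extend_measure (hbelow U M) (internal_subsets M) (\<lambda>B. B)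
       (\<lambda>B. ennreal (loeb_mass M B))"
  have loeb: "loeb_measure U (hbelow U M) = completion N"
    unfolding loeb_measure_def N_def internal_subsets_def loeb_mass_def ..
  have sub: "(\<lambda>B. B) ` internal_subsets M \<subseteq> Pow (hbelow U M)"
    by (auto simp: internal_subsets_def)
  have space: "space N = hbelow U M"
    unfolding N_def by (rule space_extend_measure[OF sub])
  have sets: "sets N = sigma_sets (hbelow U M) (internal_subsets M)"
    unfolding N_def by (simp add: sets_extend_measure[OF sub])
  have mass: "emeasure N B = ennreal (loeb_mass M B)" if B: "B \<in> internal_subsets M" for B
  proof -
    obtain \<mu> where \<mu>: "\<And>B. B \<in> internal_subsets M \<Longrightarrow> \<mu> B = ennreal (loeb_mass M B)"
      "measure_space (hbelow U M) (sigma_sets (hbelow U M) (internal_subsets M)) \<mu>"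
      using loeb_mass_extends[OF M(1)] by blast
    show ?thesis
      by (rule emeasure_extend_measure[OF N_def \<mu>(1) sub _ _ B])
        (use \<mu>(2) in \<open>simp_all add: sets measure_space_def\<close>)
  qed
  have gen: "B \<in> sets N" if "B \<in> internal_subsets M" for B
    using that sets by auto
  have whole: "hbelow U M \<in> internal_subsets M"
    by (simp add: internal_subsets_def internal_hbelow)
  show space': "space (loeb_measure U (hbelow U M)) = hbelow U M"
    by (simp add: loeb space)
  show "prob_space (loeb_measure U (hbelow U M))"
    unfolding space' loeb
    by (rule prob_spaceI) (simp add: space emeasure_completion gen whole mass loeb_mass_whole[OF M])
  assume B: "B \<subseteq> hbelow U M" "internal_set U B"
  then have "B \<in> internal_subsets M" by (simp add: internal_subsets_def)
  then show "B \<in> sets (loeb_measure U (hbelow U M))"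
    and "emeasure (loeb_measure U (hbelow U M)) B = ennreal (loeb_mass M B)"
    using gen mass by (simp_all add: loeb)
qed

text \<open>
  By saturation, since finitely many conditions \<open>n < x\<close> are satisfied by a standard number.
\<close>

lemma ex_infinite_hnat: "\<exists>N. infinite_hnat U N"
proof -
  define A where "A = (\<lambda>n. {x. hless U (emb U (num U n)) x})"
  define greater where "greater = {[x, y] |x y. [y, x] \<in> less_rel}"
  have in_greater: "[x, y] \<in> greater \<longleftrightarrow> [y, x] \<in> less_rel" for x y
    by (simp add: greater_def del: in_less_rel)
  have "A n = slice greater [emb U (num U n)]" for n
  proof -
    have "[x, y] \<in> star U greater \<longleftrightarrow> hless U y x" for x y
    proof -
      have "holds (star U) (Conj (Imp (Rel greater [0, 1]) (Rel less_rel [1, 0]))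
          (Imp (Rel less_rel [1, 0]) (Rel greater [0, 1]))) ((\<lambda>_. x)(1 := y))"
        by (rule transfer) (auto simp: in_greater)
      then show ?thesis by (auto simp: in_hless)
    qed
    then show ?thesis by (simp add: A_def slice_def)
  qed
  then have int: "internal_set U (A n)" for n by (simp add: internal_setI)
  have "emb U (num U (Suc n)) \<in> (\<Inter>k\<le>n. A k)" for n
    by (simp add: A_def standard_hless less_Suc_eq_le)
  then have ne: "(\<Inter>k\<le>n. A k) \<noteq> {}" for n by blast
  have "aleph1_saturated U"
    using universe by (simp add: nonstandard_universe_def)
  then have "(\<Inter>n. A n) \<noteq> {}"
    unfolding aleph1_saturated_def using int ne by blast
  then obtain N where N: "\<And>n. N \<in> A n" by blast
  then have "hless U (emb U (num U n)) N" for n by (simp add: A_def)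
  then show ?thesis
    unfolding infinite_hnat_def using hless_hnat(2) by blast
qed

lemma infinite_hnat_mono:
  assumes "infinite_hnat U N" "hless U N M"
  shows "infinite_hnat U M"
  using assms hless_trans hless_hnat unfolding infinite_hnat_def by blast

lemma ex_star_value:
  assumes "N \<in> hnat U"
  shows "\<exists>M. [N, M] \<in> star U {[num U n, num U (m n)] |n. True}"
proof -
  have "holds (star U) (Imp (Rel nat_rel [0]) (Exists 1 (Rel {[num U n, num U (m n)] |n. True} [0, 1])))
      (\<lambda>_. N)"
    by (rule transfer) auto
  then show ?thesis using assms by (simp add: in_hnat)
qed

end

section \<open>A hyperfinite cycle as the limit of finite cycles\<close>

text \<open>
  For a sequence of finite cycles \<open>{0, \<dots>, m n - 1}\<close> with \<open>m n > n\<close>, the cycle at the infinite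
  index \<open>N\<close> has length \<open>M\<close>, the value of the extension of \<open>m\<close> at \<open>N\<close>.
\<close>

locale nonstandard_cycle = nonstandard U for U :: "('u, 'v) ns_universe" +
  fixes m :: "nat \<Rightarrow> nat" and N M :: 'v
  assumes m: "n < m n"
    and N: "infinite_hnat U N"
    and M: "[N, M] \<in> star U {[num U n, num U (m n)] |n. True}"
begin

abbreviation length_rel :: "'u list set" where
  "length_rel \<equiv> {[num U n, num U (m n)] |n. True}"

lemma hless_N_M: "hless U N M"
proof -
  have "holds (star U) (Imp (Rel length_rel [0, 1]) (Rel less_rel [0, 1])) ((\<lambda>_. M)(0 := N))"
    by (rule transfer) (use m in auto)
  then show ?thesis using M by (simp add: in_hless)
qed

lemma M_hnat: "M \<in> hnat U" and infinite_M: "infinite_hnat U M"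
  using hless_N_M N hless_hnat infinite_hnat_mono by blast+

lemma M_pos: "hless U (emb U (num U 0)) M"
  using infinite_M by (simp add: infinite_hnat_def)

abbreviation Y :: "'v set" where "Y \<equiv> hbelow U M"

text \<open>
  If \<open>Q n\<close> marks positions of the \<open>n\<close>-th cycle, these are the positions marked in the
  cycle at index \<open>N\<close>.
\<close>

definition star_set :: "(nat \<Rightarrow> nat \<Rightarrow> bool) \<Rightarrow> 'v set" where
  "star_set Q = Y \<inter> slice {[num U k, num U n] |k n. Q n k} [N]"

lemma internal_star_set: "internal_set U (star_set Q)"
  unfolding star_set_def by (intro internal_Int internal_hbelow internal_setI)

lemma star_set_conj: "star_set (\<lambda>n k. Q n k \<and> R n k) = star_set Q \<inter> star_set R"
proof -
  have "{[num U k, num U n] |k n. Q n k \<and> R n k} =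
      {[num U k, num U n] |k n. Q n k} \<inter> {[num U k, num U n] |k n. R n k}"
    by auto
  then show ?thesis by (auto simp: star_set_def slice_Int)
qed

lemma star_set_True: "star_set (\<lambda>n k. True) = Y"
proof -
  have "[y, N] \<in> star U {[num U k, num U n] |k n. True}" if "y \<in> Y" for y
  proof -
    have "holds (star U) (Imp (Conj (Rel nat_rel [0]) (Rel nat_rel [1]))
        (Rel {[num U k, num U n] |k n. True} [0, 1])) ((\<lambda>_. N)(0 := y))"
      by (rule transfer) auto
    then show ?thesis using that N by (auto simp: in_hnat hbelow_def infinite_hnat_def)
  qed
  then show ?thesis by (auto simp: star_set_def slice_def)
qed

lemma star_set_ball:
  assumes "finite J"
  shows "star_set (\<lambda>n k. \<forall>i\<in>J. Q i n k) = {y \<in> Y. \<forall>i\<in>J. y \<in> star_set (Q i)}"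
  using assms
proof (induction J)
  case empty
  show ?case by (simp add: star_set_True)
next
  case (insert i J)
  then show ?case by (auto simp: star_set_conj)
qed

text \<open>
  For every standard \<open>\<epsilon> > 0\<close> the frequencies are within \<open>\<epsilon>\<close> of \<open>r\<close> from some standard index
  on, and by transfer also at the infinite index \<open>N\<close>; this identifies the standard part.
\<close>

lemma loeb_star_set:
  assumes lim: "(\<lambda>n. real (card {k. k < m n \<and> Q n k}) / real (m n)) \<longlonglongrightarrow> r"
  shows "emeasure (loeb_measure U Y) (star_set Q) = ennreal r"
proof -
  let ?E = "{[num U k, num U n] |k n. Q n k}"
  have mem: "members ?E i [num U n] = {k. k < i \<and> Q n k}" for i n
    by (auto simp: members_def)
  have "loeb_mass M (Y \<inter> slice ?E [N]) = r"
  proof (rule loeb_mass_eqI[OF M_hnat])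
    fix j \<epsilon> assume "\<epsilon> > (0::real)" and j: "j # M # [N] \<in> star U (count_rel ?E)"
    then obtain n0 where n0: "\<And>n. n > n0 \<Longrightarrow> \<bar>real (card {k. k < m n \<and> Q n k}) / real (m n) - r\<bar> < \<epsilon>"
      using lim unfolding LIMSEQ_iff by (metis less_or_eq_imp_le real_norm_def)
    let ?B = "{[num U n] |n. n > n0}"
    have "holds (star U) (Imp (Conj (Rel (count_rel ?E) [0, 1, 2])
        (Conj (Rel length_rel [2, 1]) (Rel ?B [2]))) (Rel (near_rel r \<epsilon>) [0, 1]))
      ((\<lambda>_. N)(0 := j, 1 := M))"
      by (rule transfer) (use n0 mem in auto)
    moreover have "[N] \<in> star U ?B"
    proof -
      have "holds (star U) (Imp (Rel {[num U n0, num U n] |n. n > n0} [0, 1]) (Rel ?B [1])) 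
        ((\<lambda>_. N)(0 := emb U (num U n0)))"
        by (rule transfer) auto
      moreover have "holds (star U) (Imp (Conj (Rel {[num U n0]} [0]) (Rel less_rel [0, 1]))
          (Rel {[num U n0, num U n] |n. n > n0} [0, 1])) ((\<lambda>_. N)(0 := emb U (num U n0)))"
        by (rule transfer) auto
      moreover have "[emb U (num U n0)] \<in> star U {[num U n0]}"
        using transfer_standard[of "[num U n0]"] by simp
      ultimately show ?thesis using N by (auto simp: infinite_hnat_def in_hless)
    qed
    ultimately show "[j, M] \<in> star U (near_rel r \<epsilon>)" using j M by simp
  qed
  then show ?thesis
    using emeasure_loeb[OF M_hnat M_pos _ internal_star_set, of Q] by (simp add: star_set_def)
qed

text \<open>
  The graph of the cyclic shift, uniformly in the length of the cycle.
\<close>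

definition succ_rel :: "'u list set" where
  "succ_rel = {[num U i, num U j, num U n] |i j n. j = Suc i mod n}"

lemma in_succ_rel [simp]: "[x, y, z] \<in> succ_rel \<longleftrightarrow>
    (\<exists>i n. x = num U i \<and> y = num U (Suc i mod n) \<and> z = num U n)"
  by (auto simp: succ_rel_def)

definition T :: "'v \<Rightarrow> 'v" where
  "T k = (THE l. [k, l, M] \<in> star U succ_rel)"

lemma T_eq:
  assumes "k \<in> Y"
  shows "[k, l, M] \<in> star U succ_rel \<longleftrightarrow> T k = l"
proof -
  have "holds (star U) (Imp (Rel less_rel [0, 1]) (Exists 2 (Rel succ_rel [0, 2, 1])))
      ((\<lambda>_. M)(0 := k))"
    by (rule transfer) auto
  then obtain l' where l': "[k, l', M] \<in> star U succ_rel"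
    using assms by (auto simp: hbelow_eq in_hless)
  have uniq: "x = y" if "[k, x, M] \<in> star U succ_rel" "[k, y, M] \<in> star U succ_rel" for x y
  proof -
    have "holds (star U) (Imp (Conj (Rel succ_rel [0, 1, 3]) (Rel succ_rel [0, 2, 3])) (Equal 1 2))
        ((\<lambda>_. M)(0 := k, 1 := x, 2 := y))"
      by (rule transfer) auto
    then show ?thesis using that by simp
  qed
  have "T k = l'" unfolding T_def using l' uniq by blast
  then show ?thesis using l' uniq by blast
qed

lemma T_graph: "k \<in> Y \<Longrightarrow> [k, T k, M] \<in> star U succ_rel"
  by (simp add: T_eq)

lemma T_in: "k \<in> Y \<Longrightarrow> T k \<in> Y"
proof -
  assume k: "k \<in> Y"
  have less: "Suc i mod n < n" if "i < n" for i n :: nat using that by simp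
  have "holds (star U)
      (Imp (Conj (Rel less_rel [0, 2]) (Rel succ_rel [0, 1, 2]))
        (Rel less_rel [1, 2]))
      ((\<lambda>_. M)(0 := k, 1 := T k))"
    by (rule transfer) (use less in auto)
  then show ?thesis using k T_graph[OF k] by (auto simp: hbelow_eq in_hless)
qed

lemma bij_T: "bij_betw T Y Y"
  unfolding bij_betw_def
proof (intro conjI inj_onI equalityI subsetI)
  fix x y assume xy: "x \<in> Y" "y \<in> Y" "T x = T y"
  have inj: "i = j" if "Suc i mod n = Suc j mod n" "i < n" "j < n" for i j n :: nat
    using that by (auto simp: mod_Suc split: if_splits)
  have "holds (star U) (Imp (Conj (Conj (Rel less_rel [0, 3]) (Rel less_rel [1, 3]))
        (Conj (Rel succ_rel [0, 2, 3]) (Rel succ_rel [1, 2, 3]))) (Equal 0 1))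
      ((\<lambda>_. M)(0 := x, 1 := y, 2 := T x))"
    by (rule transfer) (auto dest: inj)
  then show "x = y"
    using xy T_graph[OF xy(1)] T_graph[OF xy(2)] by (simp add: hbelow_eq in_hless)
next
  fix y assume "y \<in> T ` Y"
  then show "y \<in> Y" using T_in by blast
next
  fix y assume y: "y \<in> Y"
  have surj: "\<exists>i<n. j = Suc i mod n" if "j < n" for j n :: nat
  proof (cases j)
    case 0
    then show ?thesis using that by (intro exI[of _ "n - 1"]) simp
  next
    case (Suc i)
    then show ?thesis using that by (intro exI[of _ i]) simp
  qed
  have "holds (star U) (Imp (Rel less_rel [0, 1]) (Exists 2 (Conj (Rel less_rel [2, 1])
      (Rel succ_rel [2, 0, 1])))) ((\<lambda>_. M)(0 := y))"
  proof (rule transfer)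
    fix e :: "nat \<Rightarrow> 'u"
    have "\<exists>x. [x, e 1] \<in> less_rel \<and> [x, e 0, e 1] \<in> succ_rel" if less: "[e 0, e 1] \<in> less_rel"
    proof -
      obtain j n where e: "e 0 = num U j" "e 1 = num U n" and "j < n"
        using less unfolding in_less_rel by blast
      then obtain i where "i < n" "j = Suc i mod n" using surj by blast
      then have "[num U i, e 1] \<in> less_rel \<and> [num U i, e 0, e 1] \<in> succ_rel"
        unfolding in_less_rel in_succ_rel e by blast
      then show ?thesis by blast
    qed
    then show "holds (\<lambda>R. R) (Imp (Rel less_rel [0, 1]) (Exists 2 (Conj (Rel less_rel [2, 1])
      (Rel succ_rel [2, 0, 1])))) e"
      by (simp del: in_less_rel in_succ_rel)
  qed
  then obtain x where "hless U x M" "[x, y, M] \<in> star U succ_rel"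
    using y by (auto simp: hbelow_eq in_hless)
  then show "y \<in> T ` Y" using T_eq[of x y] by (auto simp: hbelow_eq)
qed

lemma transitive_T: "transitive_loeb_system U Y T"
proof -
  note hM = has_hcard_hbelow[OF M_hnat]
  have card: "hcard U Y = M" by (rule hcard_eqI[OF hM])
  let ?G = "{[num U i, num U (Suc i mod n), num U n] |i n. i < n}"
  have "[x, y, M] \<in> star U ?G \<longleftrightarrow> hless U x M \<and> [x, y, M] \<in> star U succ_rel" for x y
  proof -
    have "holds (star U) (Conj (Imp (Rel ?G [0, 1, 2]) (Conj (Rel less_rel [0, 2]) (Rel succ_rel [0, 1, 2])))
        (Imp (Conj (Rel less_rel [0, 2]) (Rel succ_rel [0, 1, 2])) (Rel ?G [0, 1, 2])))
        ((\<lambda>_. M)(0 := x, 1 := y))"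
      by (rule transfer) auto
    then show ?thesis by (auto simp: in_hless)
  qed
  then have "{(x, T x) |x. x \<in> Y} = {(x, y). x # y # [M] \<in> star U ?G}"
    using T_eq by (auto simp: hbelow_eq)
  then have T: "internal_fun_on U Y T"
    unfolding internal_fun_on_def internal_rel_def by blast
  \<comment> \<open>The identity enumerates the cycle, so the internal permutation is a single cycle by construction.\<close>
  have "T k = l" if "k \<in> Y" "[k, l, M] \<in> star U succ_rel" for k l
    using that T_eq by blast
  then have "hcycle_on U Y M T"
    unfolding hcycle_on_def succ_rel_def
    by (intro exI[of _ id] conjI internal_fun_on_id bij_betw_id) simp
  then show ?thesis
    unfolding transitive_loeb_system_def hyperfinite_def card
    using internal_hbelow hM infinite_M T bij_T by blast
qed

text \<open>
  The shift on the limit cycle can be moved into the marking; joint events for \<open>y\<close> and \<open>T y\<close>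
  are thereby limits of events on the finite cycles as well.
\<close>

lemma T_star_set:
  assumes "y \<in> Y"
  shows "T y \<in> star_set Q \<longleftrightarrow> y \<in> star_set (\<lambda>n k. Q n (Suc k mod m n))"
proof -
  let ?Q = "{[num U k, num U n] |k n. Q n k}"
  let ?Q' = "{[num U k, num U n] |k n. Q n (Suc k mod m n)}"
  have "holds (star U) (Imp (Conj (Rel succ_rel [0, 1, 2]) (Rel length_rel [3, 2]))
      (Conj (Imp (Rel ?Q [1, 3]) (Rel ?Q' [0, 3])) (Imp (Rel ?Q' [0, 3]) (Rel ?Q [1, 3]))))
      ((\<lambda>_. N)(0 := y, 1 := T y, 2 := M))"
    by (rule transfer) auto
  then show ?thesis
    using T_graph[OF assms] M T_in[OF assms] assms by (auto simp: star_set_def slice_def)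
qed

end

section \<open>Finite cycles that approximate a measure preserving map\<close>

lemma measure_preserving_funpow:
  assumes "measure_preserving M M f"
  shows "measure_preserving M M (f ^^ n)"
proof (induction n)
  case 0
  show ?case by (simp add: measure_preserving_def id_def Int_absorb2 sets.sets_into_space)
next
  case (Suc n)
  have f: "f \<in> measurable M M" and fn: "f ^^ n \<in> measurable M M"
    using assms Suc by (simp_all add: measure_preserving_def)
  have "emeasure M ((f ^^ Suc n) -` A \<inter> space M) = emeasure M A" if A: "A \<in> sets M" for A
  proof -
    have "(f ^^ Suc n) -` A \<inter> space M = (f ^^ n) -` (f -` A \<inter> space M) \<inter> space M"
      using measurable_space[OF fn] by auto
    moreover have "emeasure M ((f ^^ n) -` (f -` A \<inter> space M) \<inter> space M)
        = emeasure M (f -` A \<inter> space M)"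
      using Suc measurable_sets[OF f A] unfolding measure_preserving_def by blast
    ultimately show ?thesis
      using assms A unfolding measure_preserving_def by simp
  qed
  then show ?case
    using measurable_comp[OF fn f] unfolding measure_preserving_def by (simp only: funpow.simps) blast
qed

text \<open>
  Rounding down costs less than one per entry, and the remaining units can all be given to one entry
  \<open>w0\<close> because only lower bounds are claimed.  Upper bounds for sums of entries follow by passing
  to the complement, as both totals agree.
\<close>

lemma rounding:
  fixes p :: "'w \<Rightarrow> real"
  assumes "finite W" "\<And>w. w \<in> W \<Longrightarrow> p w \<ge> 0" "sum p W = 1" 
  shows "\<exists>c :: 'w \<Rightarrow> nat. sum c W = N \<and> (\<forall>w\<in>W. real (c w) \<ge> real N * p w - 1)"
proof -
  let ?c = "\<lambda>w. nat \<lfloor>real N * p w\<rfloor>"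
  have le: "real (?c w) \<le> real N * p w" if "w \<in> W" for w
    using assms(2)[OF that] by simp
  have "real (sum ?c W) \<le> (\<Sum>w\<in>W. real N * p w)"
    unfolding of_nat_sum by (rule sum_mono) (rule le)
  also have "\<dots> = real N" using assms(3) by (simp flip: sum_distrib_left)
  finally have sum_le: "sum ?c W \<le> N" by linarith
  from assms(3) obtain w0 where w0: "w0 \<in> W" by fastforce
  let ?d = "\<lambda>w. ?c w + (if w = w0 then N - sum ?c W else 0)"
  have "sum ?d W = N"
    using sum_le w0 assms(1) by (simp add: sum.distrib)
  moreover have "real (?d w) \<ge> real N * p w - 1" if "w \<in> W" for w
  proof -
    have "real N * p w - 1 \<le> real (?c w)" by linarith
    then show ?thesis by simp
  qed
  ultimately show ?thesis by blast
qed

text \<open>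
  A finite family of events generates a finite partition of the space into atoms.  Choosing points in
  the atoms with multiplicities proportional to the probabilities, up to rounding, gives a
  sample whose empirical measure is close to the given one on the family.  Only atoms that contain
  a point are used, so a point of every atom is available.
\<close>

lemma (in prob_space) sampling:
  assumes "finite F" "F \<subseteq> events" "\<epsilon> > 0"
  shows "\<exists>(N::nat) x. N > 0 \<and> (\<forall>r. x r \<in> space M) \<and>
    (\<forall>A\<in>F. \<bar>real (card {r. r < N \<and> x r \<in> A}) - real N * prob A\<bar> \<le> \<epsilon> * real N)"
proof -
  define pat where "pat = (\<lambda>x. {A \<in> F. x \<in> A})"
  define W where "W = pat ` space M"
  define atom where "atom = (\<lambda>w. {x \<in> space M. pat x = w})"
  have fin: "finite W"
    by (rule finite_subset[of _ "Pow F"]) (auto simp: W_def pat_def assms(1))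
  have atom: "atom w \<in> events" if "w \<in> W" for w
  proof -
    have wF: "w \<subseteq> F" using that by (auto simp: W_def pat_def)
    have "atom w = {x \<in> space M. (\<forall>A\<in>w. x \<in> A) \<and> (\<forall>A\<in>F - w. x \<notin> A)}"
      using wF by (auto simp: atom_def pat_def)
    moreover have "{x \<in> space M. (\<forall>A\<in>w. x \<in> A) \<and> (\<forall>A\<in>F - w. x \<notin> A)} \<in> events"
    proof (intro sets.sets_Collect_conj sets.sets_Collect_finite_All)
      show "finite w" "finite (F - w)" using wF assms(1) finite_subset by auto
      show "{x \<in> space M. x \<in> A} \<in> events" if "A \<in> w" for A
        using that wF assms(2) by (auto simp: Int_def[symmetric] Collect_conj_eq)
      show "{x \<in> space M. x \<notin> A} \<in> events" if "A \<in> F - w" for A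
        using that assms(2) by (auto simp: set_diff_eq[symmetric])
    qed
    ultimately show ?thesis by simp
  qed
  have disj: "disjoint_family_on atom V" for V
    by (auto simp: disjoint_family_on_def atom_def)
  have prob_eq: "prob A = (\<Sum>w\<in>{w \<in> W. A \<in> w}. prob (atom w))" if "A \<in> F" for A
  proof -
    have "A \<subseteq> space M" using that assms(2) sets.sets_into_space by blast
    then have "A = (\<Union>w\<in>{w \<in> W. A \<in> w}. atom w)"
      using that by (auto simp: W_def atom_def pat_def)
    then have "prob A = prob (\<Union>w\<in>{w \<in> W. A \<in> w}. atom w)" by simp
    also have "\<dots> = (\<Sum>w\<in>{w \<in> W. A \<in> w}. prob (atom w))"
      by (rule finite_measure_finite_Union) (use fin atom disj in auto)
    finally show ?thesis .
  qed
  have "prob (\<Union>w\<in>W. atom w) = (\<Sum>w\<in>W. prob (atom w))"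
    by (rule finite_measure_finite_Union) (use fin atom disj in auto)
  moreover have "(\<Union>w\<in>W. atom w) = space M"
    by (auto simp: W_def atom_def)
  ultimately have one: "(\<Sum>w\<in>W. prob (atom w)) = 1"
    using prob_space by simp
  obtain N :: nat where N: "real (card W) / \<epsilon> < real N" using reals_Archimedean2 by blast
  have "0 \<le> real (card W) / \<epsilon>" using assms(3) by simp
  then have "0 < real N" using N by linarith
  then have N0: "N > 0" by simp
  have cardW: "real (card W) \<le> \<epsilon> * real N"
    using N assms(3) by (simp add: field_simps)
  obtain c where c: "sum c W = N" "\<And>w. w \<in> W \<Longrightarrow> real (c w) \<ge> real N * prob (atom w) - 1"
    using rounding[OF fin _ one, of N] by auto
  \<comment> \<open>The multiplicities c are realised by enumerating the pairs of an atom and one of its c copies.\<close>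
  let ?S = "Sigma W (\<lambda>w. {..<c w})"
  have "card ?S = N" using fin c(1) by simp
  then obtain h where h: "bij_betw h {0..<N} ?S"
    using ex_bij_betw_nat_finite[of ?S] fin by auto
  have "space M \<noteq> {}" by (rule not_empty)
  then obtain a where a: "a \<in> space M" by blast
  \<comment> \<open>Beyond N the value is irrelevant; a keeps it in the space.\<close>
  define x where "x = (\<lambda>r. if r < N then (SOME y. y \<in> space M \<and> pat y = fst (h r)) else a)"
  have x: "x r \<in> space M \<and> pat (x r) = fst (h r)" if "r < N" for r
  proof -
    have "h r \<in> ?S" by (rule bij_betwE[OF h, rule_format]) (simp add: that)
    then have "fst (h r) \<in> W" by auto
    then have "\<exists>y. y \<in> space M \<and> pat y = fst (h r)" by (auto simp: W_def)
    from someI_ex[OF this] show ?thesis using that by (simp add: x_def)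
  qed
  have count: "card {r. r < N \<and> x r \<in> A} = (\<Sum>w\<in>{w \<in> W. A \<in> w}. c w)" if A: "A \<in> F" for A
  proof -
    have "x r \<in> A \<longleftrightarrow> A \<in> fst (h r)" if "r < N" for r
      using x[OF that] A by (auto simp: pat_def)
    moreover have "h r \<in> Sigma {w \<in> W. A \<in> w} (\<lambda>w. {..<c w}) \<longleftrightarrow> A \<in> fst (h r)" if "r < N" for r
      using bij_betwE[OF h, rule_format, of r] that by (cases "h r") auto
    ultimately have "{r. r < N \<and> x r \<in> A}
        = {r \<in> {0..<N}. h r \<in> Sigma {w \<in> W. A \<in> w} (\<lambda>w. {..<c w})}"
      by auto
    moreover have "h ` \<dots> = Sigma {w \<in> W. A \<in> w} (\<lambda>w. {..<c w})"
    proof -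
      have "h ` {r \<in> D. h r \<in> Z} = Z" if Z: "Z \<subseteq> h ` D" for D Z
      proof (intro equalityI subsetI)
        fix y assume y: "y \<in> Z"
        then obtain r where "r \<in> D" "y = h r" using Z by blast
        then show "y \<in> h ` {r \<in> D. h r \<in> Z}" using y by (intro image_eqI[of _ _ r]) auto
      qed auto
      then show ?thesis by this (unfold bij_betw_imp_surj_on[OF h], auto)
    qed
    moreover have "inj_on h {r \<in> {0..<N}. h r \<in> Sigma {w \<in> W. A \<in> w} (\<lambda>w. {..<c w})}"
      by (rule inj_on_subset[OF bij_betw_imp_inj_on[OF h]]) blast
    ultimately have "card {r. r < N \<and> x r \<in> A} = card (Sigma {w \<in> W. A \<in> w} (\<lambda>w. {..<c w}))"
      using card_image by fastforce
    then show ?thesis using fin by simp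
  qed
  have lower: "(\<Sum>w\<in>V. real (c w) - real N * prob (atom w)) \<ge> - real (card W)" if "V \<subseteq> W" for V
  proof -
    have "(\<Sum>w\<in>V. real (c w) - real N * prob (atom w)) \<ge> (\<Sum>w\<in>V. - 1)"
      by (rule sum_mono) (use c(2) that in force)
    moreover have "card V \<le> card W" using that fin by (rule card_mono[rotated])
    ultimately show ?thesis by simp
  qed
  have "\<bar>real (card {r. r < N \<and> x r \<in> A}) - real N * prob A\<bar> \<le> \<epsilon> * real N" if A: "A \<in> F" for A
  proof -
    let ?V = "{w \<in> W. A \<in> w}"
    let ?D = "\<lambda>V. \<Sum>w\<in>V. real (c w) - real N * prob (atom w)"
    have "?D W = ?D ?V + ?D (W - ?V)"
      using sum.subset_diff[of ?V W "\<lambda>w. real (c w) - real N * prob (atom w)"] fin by simp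
    moreover have "?D W = 0"
      using c(1) one by (simp add: sum_subtractf flip: sum_distrib_left of_nat_sum)
    moreover have "real (card {r. r < N \<and> x r \<in> A}) - real N * prob A = ?D ?V"
      unfolding count[OF A] prob_eq[OF A] by (simp add: sum_subtractf sum_distrib_left)
    ultimately show ?thesis
      using lower[of ?V] lower[of "W - ?V"] cardW by (simp add: Collect_subset)
  qed
  moreover have "x r \<in> space M" for r using x[of r] a by (cases "r < N") (simp_all add: x_def)
  ultimately show ?thesis using N0 by blast
qed

text \<open>
  The cycle consists of \<open>N\<close> orbit pieces of length \<open>L\<close>; position \<open>r * L + s\<close> holds the \<open>s\<close>-th
  image of the \<open>r\<close>-th sample point.  The sample is taken accurate to \<open>1 / L\<close> on the preimages of
  the relevant events under the first \<open>L\<close> powers of the map, all of which have the probability of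
  the event itself.  The sampling error and the \<open>N\<close> seams, out of \<open>N * L\<close> positions, contribute
  \<open>1 / L\<close> each.
\<close>

lemma (in prob_space) cyclic_pseudo_orbit:
  assumes T: "measure_preserving M M T"
    and S: "finite S" "S \<subseteq> events \<times> events"
  shows "\<exists>m z. n < m \<and> (\<forall>k. z k \<in> space M) \<and> (\<forall>(A, B)\<in>S.
    \<bar>real (card {k. k < m \<and> z k \<in> A \<and> z (Suc k mod m) \<in> B}) / real m
      - prob {x \<in> space M. x \<in> A \<and> T x \<in> B}\<bar> \<le> 2 / real (Suc n))"
proof -
  define L where "L = Suc n"
  have L: "L > 0" by (simp add: L_def)
  define C where "C = (\<lambda>(A, B). {x \<in> space M. x \<in> A \<and> T x \<in> B})"
  have TM: "T \<in> measurable M M" using T by (simp add: measure_preserving_def)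
  note TnM = measurable_compose_n[OF TM]
  have C: "C AB \<in> events" if "AB \<in> S" for AB
  proof -
    obtain A B where AB: "AB = (A, B)" "A \<in> events" "B \<in> events" using \<open>AB \<in> S\<close> S(2) by auto
    have "C AB = A \<inter> (T -` B \<inter> space M)"
      using AB sets.sets_into_space[OF AB(2)] by (auto simp: C_def)
    then show ?thesis using AB measurable_sets[OF TM] by auto
  qed
  define F where "F = (\<lambda>(s, AB). (T ^^ s) -` C AB \<inter> space M) ` ({..<L} \<times> S)"
  have "finite F" by (simp add: F_def S(1))
  moreover have "F \<subseteq> events" using C measurable_sets[OF TnM] by (auto simp: F_def)
  moreover have "1 / real L > 0" using L by simp
  ultimately have "\<exists>(N::nat) x. N > 0 \<and> (\<forall>r. x r \<in> space M) \<and> (\<forall>A\<in>F.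
      \<bar>real (card {r. r < N \<and> x r \<in> A}) - real N * prob A\<bar> \<le> 1 / real L * real N)"
    by (rule sampling)
  then obtain N x where N: "N > 0" and x: "\<And>r. x r \<in> space M" and
    smp: "\<And>A. A \<in> F \<Longrightarrow>
      \<bar>real (card {r. r < N \<and> x r \<in> A}) - real N * prob A\<bar> \<le> 1 / real L * real N"
    by blast
  define m where "m = N * L"
  define z where "z = (\<lambda>k. (T ^^ (k mod L)) (x (k div L)))"
  have z: "z k \<in> space M" for k
    unfolding z_def by (rule measurable_space[OF TnM x])
  have split: "card {k. k < m \<and> Q k} = (\<Sum>s<L. card {r. r < N \<and> Q (r * L + s)})" for Q
  proof -
    have "{k. k < m \<and> Q k} = (\<Union>s<L. (\<lambda>r. r * L + s) ` {r. r < N \<and> Q (r * L + s)})"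
    proof (intro equalityI subsetI)
      fix k assume k: "k \<in> {k. k < m \<and> Q k}"
      have "k = k div L * L + k mod L" "k mod L < L" "k div L < N"
        using k L by (auto simp: m_def less_mult_imp_div_less)
      then show "k \<in> (\<Union>s<L. (\<lambda>r. r * L + s) ` {r. r < N \<and> Q (r * L + s)})"
        using k by (intro UN_I[of "k mod L"] image_eqI[of _ _ "k div L"]) auto
    next
      fix k assume "k \<in> (\<Union>s<L. (\<lambda>r. r * L + s) ` {r. r < N \<and> Q (r * L + s)})"
      then obtain s r where sr: "s < L" "r < N" "Q k" "k = r * L + s" by auto
      have "k < Suc r * L" using sr by simp
      also have "\<dots> \<le> m" unfolding m_def using sr by (intro mult_right_mono) auto
      finally show "k \<in> {k. k < m \<and> Q k}" using sr by simp
    qed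
    also have "card \<dots> = (\<Sum>s<L. card ((\<lambda>r. r * L + s) ` {r. r < N \<and> Q (r * L + s)}))"
    proof (rule card_UN_disjoint)
      show "\<forall>i\<in>{..<L}. \<forall>j\<in>{..<L}. i \<noteq> j \<longrightarrow>
          (\<lambda>r. r * L + i) ` {r. r < N \<and> Q (r * L + i)} \<inter>
          (\<lambda>r. r * L + j) ` {r. r < N \<and> Q (r * L + j)} = {}"
      proof (intro ballI impI)
        fix i j assume ij: "i \<in> {..<L}" "j \<in> {..<L}" "i \<noteq> j"
        have "r * L + i \<noteq> r' * L + j" for r r'
        proof
          assume "r * L + i = r' * L + j"
          then have "(r * L + i) mod L = (r' * L + j) mod L" by simp
          then show False using ij by simp
        qed
        then show "(\<lambda>r. r * L + i) ` {r. r < N \<and> Q (r * L + i)} \<inter>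
          (\<lambda>r. r * L + j) ` {r. r < N \<and> Q (r * L + j)} = {}" by auto
      qed
    qed auto
    also have "\<dots> = (\<Sum>s<L. card {r. r < N \<and> Q (r * L + s)})"
      using L by (intro sum.cong card_image refl inj_onI) auto
    finally show ?thesis .
  qed
  have main: "\<bar>real (card {k. k < m \<and> z k \<in> A \<and> z (Suc k mod m) \<in> B}) / real m
      - prob {x \<in> space M. x \<in> A \<and> T x \<in> B}\<bar> \<le> 2 / real L" if AB: "(A, B) \<in> S" for A B
  proof -
    let ?C = "C (A, B)"
    let ?K = "{k. k < m \<and> z k \<in> A \<and> z (Suc k mod m) \<in> B}"
    let ?K' = "{k. k < m \<and> z k \<in> ?C}"
    let ?seam = "{k. k < m \<and> Suc (k mod L) = L}"
    have fin: "finite ?K" "finite ?K'" "finite ?seam" by simp_all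
    have "card ?seam = (\<Sum>s<L. card {r. r < N \<and> Suc ((r * L + s) mod L) = L})" by (rule split)
    also have "\<dots> = (\<Sum>s<L. if s = n then N else 0)"
    proof (rule sum.cong[OF refl])
      fix s assume "s \<in> {..<L}"
      then have "(r * L + s) mod L = s" for r by simp
      then show "card {r. r < N \<and> Suc ((r * L + s) mod L) = L} = (if s = n then N else 0)"
        by (simp add: L_def)
    qed
    finally have seam: "card ?seam = N" by (simp add: L_def)
    have step: "z (Suc k mod m) = T (z k)" if k: "k < m" "Suc (k mod L) \<noteq> L" for k
    proof -
      have ml: "Suc k mod L = Suc (k mod L)" "Suc k div L = k div L"
        using k L by (simp_all add: mod_Suc div_Suc)
      have "Suc k \<noteq> m"
      proof
        assume "Suc k = m"
        then have "Suc k mod L = 0" by (simp add: m_def)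
        then show False using ml by simp
      qed
      then have "Suc k mod m = Suc k" using k by simp
      then show ?thesis by (simp add: z_def ml)
    qed
    have "k \<in> ?K \<longleftrightarrow> k \<in> ?K'" if "k \<notin> ?seam" for k
      using that step[of k] z[of k] by (auto simp: C_def)
    then have "?K \<subseteq> ?K' \<union> ?seam" "?K' \<subseteq> ?K \<union> ?seam" by blast+
    then have "card ?K \<le> card ?K' + card ?seam" "card ?K' \<le> card ?K + card ?seam"
      using fin by (blast intro: order_trans[OF card_mono card_Un_le])+
    then have diff: "\<bar>real (card ?K) - real (card ?K')\<bar> \<le> real N" unfolding seam by linarith
    have inv: "prob ((T ^^ s) -` ?C \<inter> space M) = prob ?C" for s
      using measure_preserving_funpow[OF T, of s] C[OF AB]
      by (simp add: measure_preserving_def measure_def)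
    have each: "\<bar>real (card {r. r < N \<and> z (r * L + s) \<in> ?C}) - real N * prob ?C\<bar> \<le> real N / real L"
      if s: "s < L" for s
    proof -
      have "{r. r < N \<and> z (r * L + s) \<in> ?C} = {r. r < N \<and> x r \<in> (T ^^ s) -` ?C \<inter> space M}"
        using s x by (auto simp: z_def)
      moreover have "(T ^^ s) -` ?C \<inter> space M \<in> F"
        using s AB by (force simp: F_def)
      ultimately show ?thesis using smp inv[of s] by fastforce
    qed
    have "real (card ?K') - real L * (real N * prob ?C)
        = (\<Sum>s<L. real (card {r. r < N \<and> z (r * L + s) \<in> ?C}) - real N * prob ?C)"
      by (simp add: split sum_subtractf)
    also have "\<bar>\<dots>\<bar> \<le> (\<Sum>s<L. real N / real L)"
      by (rule order_trans[OF sum_abs sum_mono]) (use each in auto)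
    also have "\<dots> = real N" using L by simp
    finally have "\<bar>real (card ?K) - real m * prob ?C\<bar> \<le> 2 * real N"
      using diff by (simp add: m_def mult.assoc mult.left_commute)
    then have "\<bar>real (card ?K) - real m * prob ?C\<bar> / real m \<le> 2 * real N / real m"
      by (rule divide_right_mono) simp
    moreover have m0: "real m > 0" using N L by (simp add: m_def)
    moreover have "2 * real N / real m = 2 / real L" using N by (simp add: m_def)
    moreover have "real (card ?K) / real m - prob ?C = (real (card ?K) - real m * prob ?C) / real m"
      using m0 by (simp add: field_simps)
    ultimately show ?thesis by (simp add: C_def abs_divide)
  qed
  have "L \<le> m" using N by (simp add: m_def)
  then have "n < m" by (simp add: L_def)
  then show ?thesis using z main unfolding L_def by blast
qed

text \<open>
  At stage \<open>n\<close> only the first \<open>n\<close> events are approximated; every finite set of events is eventually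
  among them.
\<close>

theorem (in prob_space) cyclic_approximation:
  assumes T: "measure_preserving M M \<tau>"
    and A: "\<And>i :: nat. A i \<in> events"
  shows "\<exists>m z. (\<forall>n. n < m n) \<and> (\<forall>J J'. finite J \<longrightarrow> finite J' \<longrightarrow>
      (\<lambda>n. real (card {k. k < m n \<and> (\<forall>i\<in>J. z n k \<in> A i) \<and> (\<forall>i\<in>J'. z n (Suc k mod m n) \<in> A i)})
          / real (m n))
        \<longlonglongrightarrow> prob {x \<in> space M. (\<forall>i\<in>J. x \<in> A i) \<and> (\<forall>i\<in>J'. \<tau> x \<in> A i)})"
proof -
  define B where "B = (\<lambda>J. {x \<in> space M. \<forall>i\<in>J. x \<in> A i})"
  have B: "B J \<in> events" if "finite J" for J
    unfolding B_def using A sets.sets_into_space[OF A]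
    by (intro sets.sets_Collect_finite_All that) (simp add: Int_absorb2 Collect_conj_eq Int_def[symmetric])
  define S where "S = (\<lambda>n. (\<lambda>(J, J'). (B J, B J')) ` (Pow {..<n} \<times> Pow {..<n}))"
  define good where "good = (\<lambda>n m z. n < m \<and> (\<forall>k. z k \<in> space M) \<and> (\<forall>(A, B)\<in>S n.
      \<bar>real (card {k. k < m \<and> z k \<in> A \<and> z (Suc k mod m) \<in> B}) / real m
        - prob {x \<in> space M. x \<in> A \<and> \<tau> x \<in> B}\<bar> \<le> 2 / real (Suc n)))"
  have "\<exists>m z. good n m z" for n
    unfolding good_def
  proof (rule cyclic_pseudo_orbit[OF T])
    show "finite (S n)" by (simp add: S_def)
    show "S n \<subseteq> events \<times> events"
      using B by (auto simp: S_def intro: finite_subset)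
  qed
  then obtain m z where good: "\<And>n. good n (m n) (z n)" by metis
  have m: "n < m n" and z: "z n k \<in> space M"
    and near: "\<forall>(A, B)\<in>S n. \<bar>real (card {k. k < m n \<and> z n k \<in> A \<and> z n (Suc k mod m n) \<in> B}) / real (m n)
      - prob {x \<in> space M. x \<in> A \<and> \<tau> x \<in> B}\<bar> \<le> 2 / real (Suc n)" for n k
    using good[of n] unfolding good_def by blast+
  have \<tau>: "\<tau> x \<in> space M" if "x \<in> space M" for x
    using T that by (auto simp: measure_preserving_def measurable_space)
  show ?thesis
  proof (intro exI conjI allI impI)
    show "n < m n" for n by (rule m)
    fix J J' :: "nat set" assume J: "finite J" "finite J'"
    let ?f = "\<lambda>n. real (card {k. k < m n \<and> (\<forall>i\<in>J. z n k \<in> A i) \<and> (\<forall>i\<in>J'. z n (Suc k mod m n) \<in> A i)})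
          / real (m n)"
    let ?p = "prob {x \<in> space M. (\<forall>i\<in>J. x \<in> A i) \<and> (\<forall>i\<in>J'. \<tau> x \<in> A i)}"
    obtain n0 where n0: "J \<union> J' \<subseteq> {..<n0}"
      using J finite_nat_iff_bounded[of "J \<union> J'"] by auto
    have "\<bar>?f n - ?p\<bar> \<le> 2 / real (Suc n)" if "n \<ge> n0" for n
    proof -
      have "J \<subseteq> {..<n}" "J' \<subseteq> {..<n}" using n0 that by auto
      then have "(B J, B J') \<in> S n" by (auto simp: S_def)
      with near[of n] have "\<bar>real (card {k. k < m n \<and> z n k \<in> B J \<and> z n (Suc k mod m n) \<in> B J'}) / real (m n)
        - prob {x \<in> space M. x \<in> B J \<and> \<tau> x \<in> B J'}\<bar> \<le> 2 / real (Suc n)" by blast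
      moreover have "{x \<in> space M. x \<in> B J \<and> \<tau> x \<in> B J'} =
          {x \<in> space M. (\<forall>i\<in>J. x \<in> A i) \<and> (\<forall>i\<in>J'. \<tau> x \<in> A i)}"
        using \<tau> by (auto simp: B_def)
      ultimately show ?thesis using z by (simp add: B_def)
    qed
    then have "\<forall>\<^sub>F n in sequentially. norm (?f n - ?p) \<le> 2 / real (Suc n)"
      unfolding eventually_sequentially real_norm_def by blast
    moreover have "(\<lambda>n. 2 / real (Suc n)) \<longlonglongrightarrow> 0"
      using tendsto_mult_right_zero[OF LIMSEQ_inverse_real_of_nat, of 2] by (simp add: divide_inverse)
    ultimately have "(\<lambda>n. ?f n - ?p) \<longlonglongrightarrow> 0" by (rule Lim_null_comparison)
    then show "?f \<longlonglongrightarrow> ?p" by (rule LIM_zero_cancel)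
  qed
qed

section \<open>Coding Lebesgue spaces by real numbers\<close>

text \<open>
  A real code of the points of a conull set that loses no measurable set: images are measurable for
  the completed law.  The completion is essential, since the measurable sets of a
  Lebesgue space are Lebesgue sets and not just Borel sets.
\<close>

definition faithful_code :: "'a measure \<Rightarrow> 'a set \<Rightarrow> ('a \<Rightarrow> real) \<Rightarrow> bool" where
  "faithful_code X X0 c \<longleftrightarrow> c \<in> borel_measurable X \<and> X0 \<in> sets X \<and> (AE x in X. x \<in> X0) \<and>
     inj_on c X0 \<and> (\<forall>A\<in>sets X. A \<subseteq> X0 \<longrightarrow> c ` A \<in> sets (completion (distr X borel c)))"

lemma sets_completion_distrI:
  assumes c: "c \<in> borel_measurable X" and S: "S \<in> sets borel" and Z: "Z \<subseteq> Z'" "Z' \<in> sets borel"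
    and null: "emeasure X (c -` Z' \<inter> space X) = 0"
  shows "S \<union> Z \<in> sets (completion (distr X borel (c :: 'a \<Rightarrow> real)))"
proof -
  have "Z' \<in> null_sets (distr X borel c)"
    using Z(2) null c by (simp add: null_sets_def emeasure_distr)
  then show ?thesis using S Z(1) by (intro sets_completionI[OF refl]) auto
qed

lemma lebesgue_set_split:
  assumes "A \<in> sets (lebesgue_on {0..1::real})"
  obtains S Z Z' where "A = S \<union> Z" "S \<in> sets borel" "Z \<subseteq> Z'" "Z' \<in> sets borel"
    "emeasure lborel Z' = 0"
proof -
  have "A \<in> sets lebesgue"
    using assms by (auto simp: sets_restrict_space_iff)
  then obtain S Z Z' where "A = S \<union> Z" "Z \<subseteq> Z'" "Z' \<in> null_sets lborel" "S \<in> sets lborel"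
    by (rule sets_completionE)
  then show thesis using that by (auto simp: null_sets_def)
qed

lemma lebesgue_on_null:
  assumes "Z \<in> sets borel" "emeasure lborel Z = 0"
  shows "emeasure (lebesgue_on {0..1::real}) (Z \<inter> {0..1}) = 0"
proof -
  have "Z \<inter> {0..1} \<in> sets lebesgue" using assms(1) by auto
  moreover have "emeasure lebesgue (Z \<inter> {0..1}) \<le> emeasure lebesgue Z"
    by (rule emeasure_mono) (use assms(1) in auto)
  ultimately show ?thesis using assms by (simp add: emeasure_restrict_space)
qed

lemma faithful_code_lebesgue: "faithful_code (lebesgue_on {0..1::real}) {0..1} (\<lambda>x. x)"
proof -
  have meas: "(\<lambda>x. x) \<in> borel_measurable (lebesgue_on {0..1::real})"
    by (rule measurable_restrict_space1) (simp add: measurable_completion)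
  have "A \<in> sets (completion (distr (lebesgue_on {0..1}) borel (\<lambda>x. x)))"
    if A01: "A \<in> sets (lebesgue_on {0..1::real})" for A
  proof -
    obtain S Z Z' where A: "A = S \<union> Z" "S \<in> sets borel" "Z \<subseteq> Z'" "Z' \<in> sets borel"
      "emeasure lborel Z' = 0"
      using lebesgue_set_split[OF A01] .
    show ?thesis
      unfolding A(1) using sets_completion_distrI[OF meas A(2-4)] lebesgue_on_null[OF A(4,5)] by simp
  qed
  then show ?thesis
    unfolding faithful_code_def using meas by (auto simp: sets_restrict_space_iff)
qed

lemma faithful_code_pmf: "faithful_code (measure_pmf (p :: nat pmf)) UNIV real"
proof -
  have "real ` A \<in> sets (completion (distr (measure_pmf p) borel real))" for A
  proof -
    have "real ` A \<in> sets borel"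
      by (rule sets.countable) (simp_all add: countable_image)
    then show ?thesis by simp
  qed
  then show ?thesis by (simp add: faithful_code_def)
qed

text \<open>
  The atoms are coded by the integers from \<open>2\<close> on, disjoint from the unit interval.
\<close>

lemma faithful_code_weighted_sum:
  "faithful_code (weighted_sum \<alpha> (lebesgue_on {0..1::real}) (measure_pmf (p :: nat pmf)))
    ({0..1} <+> UNIV) (case_sum (\<lambda>x. x) (\<lambda>n. real n + 2))"
  (is "faithful_code ?W _ ?c")
proof -
  have space: "space ?W = {0..1} <+> UNIV" by (simp add: space_weighted_sum)
  have "?c -` S \<inter> space ?W = (S \<inter> {0..1}) <+> ((\<lambda>n. real n + 2) -` S)" for S
    by (auto simp: space)
  moreover have "S \<inter> {0..1} \<in> sets (lebesgue_on {0..1})" if "S \<in> sets borel" for S :: "real set"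
    using that by (auto simp: sets_restrict_space_iff)
  ultimately have meas: "?c \<in> borel_measurable ?W"
    by (intro measurableI) (auto simp: sets_weighted_sum)
  have "?c ` V \<in> sets (completion (distr ?W borel ?c))" if V: "V \<in> sets ?W" for V
  proof -
    obtain A B where AB: "V = A <+> B" "A \<in> sets (lebesgue_on {0..1})"
      using V by (auto simp: sets_weighted_sum)
    obtain S Z Z' where A: "A = S \<union> Z" "S \<in> sets borel" "Z \<subseteq> Z'" "Z' \<in> sets borel"
      "emeasure lborel Z' = 0"
      using lebesgue_set_split[OF AB(2)] .
    have A01: "A \<subseteq> {0..1}" using sets.sets_into_space[OF AB(2)] by simp
    have "(\<lambda>n. real n + 2) ` B \<in> sets borel"
      by (rule sets.countable) (simp_all add: countable_image)
    then have S: "S \<union> (\<lambda>n. real n + 2) ` B \<in> sets borel" using A(2) by auto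
    \<comment> \<open>The exceptional set is cut down to the unit interval to keep it away from the codes of the atoms.\<close>
    have "?c -` (Z' \<inter> {0..1}) \<inter> space ?W = (Z' \<inter> {0..1}) <+> {}"
      by (auto simp: space)
    moreover have "emeasure ?W ((Z' \<inter> {0..1}) <+> {}) = 0"
      using lebesgue_on_null[OF A(4,5)] A(4)
      by (subst emeasure_weighted_sum) (auto simp: sets_restrict_space_iff)
    ultimately have "(S \<union> (\<lambda>n. real n + 2) ` B) \<union> Z \<in> sets (completion (distr ?W borel ?c))"
      using A A01 by (intro sets_completion_distrI[OF meas S, of _ "Z' \<inter> {0..1}"]) auto
    moreover have "?c ` V = (S \<union> (\<lambda>n. real n + 2) ` B) \<union> Z"
      unfolding AB(1) A(1) Plus_def image_Un image_image by auto
    ultimately show ?thesis by simp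
  qed
  moreover have "inj_on ?c ({0..1} <+> UNIV)" by (auto simp: inj_on_def)
  moreover have "{0..1} <+> UNIV \<in> sets ?W"
    using sets.top[of ?W] by (simp add: space)
  moreover have "AE x in ?W. x \<in> {0..1} <+> UNIV"
    by (rule AE_I2) (simp only: space)
  ultimately show ?thesis unfolding faithful_code_def using meas by blast
qed

text \<open>
  An isomorphism modulo null sets carries the code over without changing its law, so measurability of
  images with respect to the completed law is inherited.
\<close>

lemma faithful_code_isomorphic:
  assumes iso: "isomorphic_mod_0 X N" and N: "faithful_code N N0 c" and N0: "N0 = space N"
  shows "\<exists>X0 c. faithful_code X X0 c"
proof -
  obtain A B f where A: "A \<in> null_sets X" and B: "B \<in> null_sets N"
    and f: "measure_isomorphism (restrict_space X (space X - A)) (restrict_space N (space N - B)) f"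
    using iso unfolding isomorphic_mod_0_def by blast
  let ?XA = "space X - A" and ?NB = "space N - B"
  let ?X = "restrict_space X ?XA" and ?N = "restrict_space N ?NB"
  have c: "c \<in> borel_measurable N" "inj_on c (space N)"
    "\<And>V. V \<in> sets N \<Longrightarrow> c ` V \<in> sets (completion (distr N borel c))"
    using N sets.sets_into_space[of _ N] by (auto simp: faithful_code_def N0)
  have X0: "?XA \<in> sets X" and N0s: "?NB \<in> sets N" using A B by auto
  have spX: "space ?X = ?XA" and spN: "space ?N = ?NB" by (auto simp: space_restrict_space)
  have bij: "bij_betw f ?XA ?NB" and fm: "f \<in> measurable ?X ?N"
    and fe: "\<And>S. S \<in> sets ?N \<Longrightarrow> emeasure ?X (f -` S \<inter> ?XA) = emeasure ?N S"
    and gm: "the_inv_into ?XA f \<in> measurable ?N ?X"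
    using f unfolding measure_isomorphism_def measure_preserving_def spX spN by auto
  define c' where "c' = (\<lambda>x. if x \<in> ?XA then c (f x) else 0)"
  have "c \<in> borel_measurable ?N" by (rule measurable_restrict_space1[OF c(1)])
  then have cf: "(\<lambda>x. c (f x)) \<in> borel_measurable ?X" by (rule measurable_compose[OF fm])
  have c': "c' \<in> borel_measurable X"
    unfolding c'_def using cf X0 
    by (subst measurable_restrict_space_iff[symmetric]) (auto simp: Int_absorb1)
  have f_in: "f x \<in> ?NB" if "x \<in> ?XA" for x using bij that by (auto simp: bij_betw_def)
  have AEX: "AE x in X. x \<in> ?XA" using AE_not_in[OF A] by auto
  have eX: "emeasure X V = emeasure ?X (V \<inter> ?XA)" if "V \<in> sets X" for V
  proof -
    have "emeasure ?X (V \<inter> ?XA) = emeasure X (V \<inter> ?XA)"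
      using X0 by (intro emeasure_restrict_space) auto
    also have "\<dots> = emeasure X V"
      by (rule emeasure_eq_AE) (use AEX X0 that in auto)
    finally show ?thesis ..
  qed
  have AEN: "AE x in N. x \<in> ?NB" using AE_not_in[OF B] by auto
  have eN: "emeasure N V = emeasure ?N (V \<inter> ?NB)" if "V \<in> sets N" for V
  proof -
    have "emeasure ?N (V \<inter> ?NB) = emeasure N (V \<inter> ?NB)"
      using N0s by (intro emeasure_restrict_space) auto
    also have "\<dots> = emeasure N V"
      by (rule emeasure_eq_AE) (use AEN N0s that in auto)
    finally show ?thesis ..
  qed
  have law: "distr X borel c' = distr N borel c"
  proof (rule measure_eqI)
    fix S assume "S \<in> sets (distr X borel c')"
    then have S: "S \<in> sets borel" by simp
    have S': "c -` S \<inter> space N \<in> sets N" by (rule measurable_sets[OF c(1) S])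
    have "(c -` S \<inter> space N) \<inter> ?NB \<in> sets ?N"
      using S' N0s by (auto simp: sets_restrict_space_iff)
    note fe[OF this]
    moreover have "f -` ((c -` S \<inter> space N) \<inter> ?NB) \<inter> ?XA = (c' -` S \<inter> space X) \<inter> ?XA"
      using f_in by (auto simp: c'_def)
    ultimately show "emeasure (distr X borel c') S = emeasure (distr N borel c) S"
      using eX[OF measurable_sets[OF c' S]] eN[OF S'] S c' c(1) by (simp add: emeasure_distr)
  qed simp
  have "c' ` V \<in> sets (completion (distr X borel c'))" if V: "V \<in> sets X" "V \<subseteq> ?XA" for V
  proof -
    have "V \<in> sets ?X" using V X0 by (auto simp: sets_restrict_space_iff)
    from measurable_sets[OF gm this] have "the_inv_into ?XA f -` V \<inter> ?NB \<in> sets N"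
      using N0s by (auto simp: spN sets_restrict_space_iff)
    moreover have "the_inv_into ?XA f -` V \<inter> ?NB = f ` V"
    proof (intro equalityI subsetI)
      fix y assume y: "y \<in> the_inv_into ?XA f -` V \<inter> ?NB"
      then have "f (the_inv_into ?XA f y) = y"
        using bij by (auto simp: bij_betw_def intro!: f_the_inv_into_f)
      then show "y \<in> f ` V" using y by (auto intro: image_eqI[OF sym])
    next
      fix y assume "y \<in> f ` V"
      then obtain x where x: "x \<in> V" "y = f x" by blast
      then have "the_inv_into ?XA f y = x"
        using bij V(2) by (auto simp: bij_betw_def intro!: the_inv_into_f_f)
      then show "y \<in> the_inv_into ?XA f -` V \<inter> ?NB" using x f_in V(2) by auto
    qed
    ultimately have "c ` f ` V \<in> sets (completion (distr N borel c))" using c(3) by simp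
    moreover have "c' ` V = c ` f ` V"
      using V(2) unfolding image_image by (intro image_cong refl) (auto simp: c'_def)
    ultimately show ?thesis by (simp add: law)
  qed
  moreover have "inj_on c' ?XA"
  proof (rule inj_onI)
    fix x y assume xy: "x \<in> ?XA" "y \<in> ?XA" "c' x = c' y"
    then have "c (f x) = c (f y)" by (simp add: c'_def)
    then have "f x = f y" using inj_onD[OF c(2)] f_in xy by blast
    then show "x = y" using bij xy by (auto simp: bij_betw_def inj_on_def)
  qed
  ultimately have "faithful_code X ?XA c'"
    unfolding faithful_code_def using c' X0 AEX by blast
  then show ?thesis by blast
qed

text \<open>
  Each of the three models of a Lebesgue space has a faithful code; to use it, one needs only a
  measurable decoding.  Off the codes of the conull set, \<open>d\<close> takes an arbitrary constant value \<open>a\<close>.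
\<close>

theorem lebesgue_space_decode:
  assumes "lebesgue_space X"
  obtains c :: "'a \<Rightarrow> real" and d where "c \<in> borel_measurable X" "d \<in> measurable (completion (distr X borel c)) X"
    "AE x in X. d (c x) = x"
proof -
  interpret prob_space X using assms by (simp add: lebesgue_space_def)
  consider "isomorphic_mod_0 X (lebesgue_on {0..1::real})"
    | (atomic) p :: "nat pmf" where "isomorphic_mod_0 X (measure_pmf p)"
    | (sum) p :: "nat pmf" and \<alpha>
      where "isomorphic_mod_0 X (weighted_sum \<alpha> (lebesgue_on {0..1::real}) (measure_pmf p))"
    using assms unfolding lebesgue_space_def by blast
  then have "\<exists>X0 c. faithful_code X X0 c"
  proof cases
    case 1
    then show ?thesis by (rule faithful_code_isomorphic[OF _ faithful_code_lebesgue]) simp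
  next
    case atomic
    then show ?thesis by (rule faithful_code_isomorphic[OF _ faithful_code_pmf]) simp
  next
    case sum
    then show ?thesis
      by (rule faithful_code_isomorphic[OF _ faithful_code_weighted_sum]) (simp add: space_weighted_sum)
  qed
  then obtain X0 c where code: "faithful_code X X0 c" by blast
  then have c: "c \<in> borel_measurable X" and X0: "X0 \<in> sets X" "AE x in X. x \<in> X0"
    and inj: "inj_on c X0"
    and image: "\<And>A. A \<in> sets X \<Longrightarrow> A \<subseteq> X0 \<Longrightarrow> c ` A \<in> sets (completion (distr X borel c))"
    unfolding faithful_code_def by blast+
  let ?\<mu> = "completion (distr X borel c)"
  obtain a where a: "a \<in> space X" using not_empty by blast
  define d where "d = (\<lambda>r. if r \<in> c ` X0 then the_inv_into X0 c r else a)"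
  have dc: "d (c x) = x" if "x \<in> X0" for x
    using that inj by (simp add: d_def the_inv_into_f_f)
  have X0_sub: "X0 \<subseteq> space X" using X0(1) by (rule sets.sets_into_space)
  have "d \<in> measurable ?\<mu> X"
  proof (rule measurableI)
    fix r
    show "d r \<in> space X"
    proof (cases "r \<in> c ` X0")
      case True
      then show ?thesis using dc X0_sub by auto
    qed (use a in \<open>simp add: d_def\<close>)
  next
    fix A assume A: "A \<in> sets X"
    have "d -` A \<inter> space ?\<mu> = c ` (A \<inter> X0) \<union> (if a \<in> A then space ?\<mu> - c ` X0 else {})"
    proof (rule set_eqI)
      fix r
      show "r \<in> d -` A \<inter> space ?\<mu> \<longleftrightarrow>
          r \<in> c ` (A \<inter> X0) \<union> (if a \<in> A then space ?\<mu> - c ` X0 else {})"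
      proof (cases "r \<in> c ` X0")
        case True
        then obtain x where "x \<in> X0" "r = c x" by blast
        then show ?thesis using dc inj by (auto simp: inj_on_def)
      next
        case False
        then show ?thesis by (auto simp: d_def)
      qed
    qed
    moreover have "c ` (A \<inter> X0) \<in> sets ?\<mu>" "c ` X0 \<in> sets ?\<mu>"
      using image A X0(1) by auto
    then have "c ` (A \<inter> X0) \<union> (if a \<in> A then space ?\<mu> - c ` X0 else {}) \<in> sets ?\<mu>"
      by (cases "a \<in> A") (auto simp del: space_completion sets_completion)
    ultimately show "d -` A \<inter> space ?\<mu> \<in> sets ?\<mu>" by simp
  qed
  moreover have "AE x in X. d (c x) = x" 
    using X0(2) by (rule eventually_mono) (rule dc)
  ultimately show thesis by (rule that[OF c])
qed

lemma distr_measure_preserving: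
  assumes "measure_preserving M N f"
  shows "distr M N f = N"
  by (rule measure_eqI) (use assms in \<open>auto simp: measure_preserving_def emeasure_distr\<close>)

lemma borel_kernel:
  assumes "A \<in> sets (completion (distr M borel c))" and c: "(c :: 'a \<Rightarrow> real) \<in> borel_measurable M"
  obtains S Z where "S \<in> sets borel" "Z \<in> null_sets (distr M borel c)"
    "\<And>r. r \<notin> Z \<Longrightarrow> r \<in> A \<longleftrightarrow> r \<in> S"
proof -
  from assms(1) obtain S N Z where A: "A = S \<union> N" "N \<subseteq> Z" "Z \<in> null_sets (distr M borel c)"
    "S \<in> sets (distr M borel c)"
    by (rule sets_completionE)
  then show thesis by (intro that[of S Z]) auto
qed

text \<open>
  A random variable \<open>h\<close> with the law of the code can be decoded to a random variable with the
  law of the coded space.  Measurability uses that \<open>L\<close> is complete: preimages under \<open>d\<close> are Borel only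
  up to subsets of null sets.
\<close>

lemma measure_preserving_decode:
  assumes c: "(c :: 'a \<Rightarrow> real) \<in> borel_measurable X"
    and d: "d \<in> measurable (completion (distr X borel c)) X"
    and dc: "AE x in X. d (c x) = x"
    and L: "complete_measure L"
    and h: "h \<in> borel_measurable L" and law: "distr L borel h = distr X borel c"
  shows "measure_preserving L X (\<lambda>y. d (h y))"
  unfolding measure_preserving_def
proof (intro conjI ballI)
  let ?\<mu> = "distr X borel c"
  have sp: "d r \<in> space X" for r using measurable_space[OF d] by simp
  have pre: "(\<lambda>y. d (h y)) -` A \<inter> space L \<in> sets L \<and>
      emeasure L ((\<lambda>y. d (h y)) -` A \<inter> space L) = emeasure X A" if A: "A \<in> sets X" for A
  proof -
    have "d -` A \<in> sets (completion ?\<mu>)" using measurable_sets[OF d A] by simp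
    then obtain S Z where S: "S \<in> sets borel" and Z: "Z \<in> null_sets ?\<mu>"
      and SZ: "\<And>r. r \<notin> Z \<Longrightarrow> r \<in> d -` A \<longleftrightarrow> r \<in> S"
      using borel_kernel[OF _ c] by blast
    let ?P = "(\<lambda>y. d (h y)) -` A \<inter> space L"
    have Zb: "Z \<in> sets borel" using Z by auto
    have SL: "h -` S \<inter> space L \<in> sets L" and ZL: "h -` Z \<inter> space L \<in> sets L"
      using S Zb h by (auto intro: measurable_sets)
    have "emeasure L (h -` Z \<inter> space L) = emeasure (distr L borel h) Z"
      using Zb h by (simp add: emeasure_distr)
    then have null: "h -` Z \<inter> space L \<in> null_sets L"
      using Z ZL law by (simp add: null_sets_def)
    have "?P \<inter> (h -` Z \<inter> space L) \<in> sets L"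
      by (rule complete_measure.complete[OF L _ null]) blast
    moreover have "?P = (h -` S \<inter> space L - (h -` Z \<inter> space L)) \<union> (?P \<inter> (h -` Z \<inter> space L))"
      using SZ by auto
    ultimately have P: "?P \<in> sets L" using SL ZL by (metis sets.Diff sets.Un)
    have "AE y in L. h y \<notin> Z" using AE_not_in[OF null] by (rule AE_mp) (rule AE_I2, simp)
    then have "emeasure L ?P = emeasure L (h -` S \<inter> space L)"
      by (intro emeasure_eq_AE P SL) (auto simp: SZ[simplified])
    also have "\<dots> = emeasure ?\<mu> S" using S h law by (simp add: emeasure_distr[symmetric])
    also have "\<dots> = emeasure X (c -` S \<inter> space X)" using S c by (simp add: emeasure_distr)
    also have "\<dots> = emeasure X A"
    proof (rule emeasure_eq_AE)
      have "AE x in X. c x \<notin> Z" using AE_distrD[OF c AE_not_in[OF Z]] .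
      with dc show "AE x in X. x \<in> c -` S \<inter> space X \<longleftrightarrow> x \<in> A"
      proof eventually_elim
        case (elim x)
        then show ?case
          using SZ[of "c x"] sets.sets_into_space[OF A] sp[of "c x"] by auto
      qed
    qed (use S c A in \<open>auto intro: measurable_sets\<close>)
    finally show ?thesis using P by blast
  qed
  show "(\<lambda>y. d (h y)) \<in> measurable L X"
    by (rule measurableI) (use sp pre in auto)
  show "emeasure L ((\<lambda>y. d (h y)) -` A \<inter> space L) = emeasure X A" if "A \<in> sets X" for A
    using pre[OF that] by blast
qed

section \<open>Laws of random sets and of cuts\<close>

text \<open>
  Random sets as random variables.  The events of containing a given finite set generate the
  \<open>\<sigma>\<close>-algebra and are closed under intersection, so they determine a law.
\<close>

definition incidence :: "'i set measure" where
  "incidence = sigma UNIV {{w. J \<subseteq> w} |J. finite J}"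

lemma sets_incidence: "sets incidence = sigma_sets UNIV {{w :: 'i set. J \<subseteq> w} |J. finite J}"
  by (simp add: incidence_def)

lemma space_incidence [simp]: "space incidence = UNIV"
  by (simp add: incidence_def space_measure_of_conv)

lemma incidence_mem: "{w. i \<in> w} \<in> sets incidence"
  unfolding sets_incidence by (rule sigma_sets.Basic) (auto intro: exI[of _ "{i}"])

lemma measurable_incidence:
  fixes Z :: "'a \<Rightarrow> 'i set"
  assumes "\<And>i. {x \<in> space M. i \<in> Z x} \<in> sets M"
  shows "Z \<in> measurable M incidence"
  unfolding incidence_def
proof (rule measurable_measure_of)
  fix A assume "A \<in> {{w :: 'i set. J \<subseteq> w} |J. finite J}"
  then obtain J where J: "finite J" "A = {w. J \<subseteq> w}" by blast
  have "Z -` A \<inter> space M = {x \<in> space M. \<forall>i\<in>J. i \<in> Z x}"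
    unfolding J(2) by auto
  also have "\<dots> \<in> sets M"
    by (rule sets.sets_Collect_finite_All[OF assms J(1)])
  finally show "Z -` A \<inter> space M \<in> sets M" .
qed auto

lemma incidence_eqI:
  assumes M: "sets M = sets incidence" and N: "sets N = sets incidence" and "finite_measure M"
    and eq: "\<And>J. finite J \<Longrightarrow> emeasure M {w. J \<subseteq> w} = emeasure N {w. J \<subseteq> w}"
  shows "M = (N :: 'i set measure)"
proof (rule measure_eqI_generator_eq)
  let ?E = "{{w :: 'i set. J \<subseteq> w} |J. finite J}"
  show "Int_stable ?E"
  proof (rule Int_stableI)
    fix A B assume "A \<in> ?E" "B \<in> ?E"
    then obtain J K where "finite J" "A = {w. J \<subseteq> w}" "finite K" "B = {w. K \<subseteq> w}" by blast
    then have "finite (J \<union> K)" "A \<inter> B = {w. J \<union> K \<subseteq> w}" by auto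
    then show "A \<inter> B \<in> ?E" by blast
  qed
  show "sets M = sigma_sets UNIV ?E" "sets N = sigma_sets UNIV ?E"
    using M N by (simp_all add: sets_incidence)
  have "(UNIV :: 'i set set) = {w. {} \<subseteq> w}" by simp
  then show "range (\<lambda>n :: nat. UNIV) \<subseteq> ?E" by blast
  show "emeasure M UNIV \<noteq> \<infinity>" 
    using finite_measure.emeasure_finite[OF \<open>finite_measure M\<close>] by simp
qed (use eq in auto)

text \<open>
  A real number is coded by the rational numbers above it.  Unlike with digit expansions, decoding is a
  countable infimum, hence measurable.
\<close>

definition cut :: "nat \<Rightarrow> real" where
  "cut i = real_of_rat (nat_to_rat_surj i)"

lemma cut_dense:
  assumes "x < y"
  obtains i where "x < cut i" "cut i < y"
proof -
  obtain r where "x < real_of_rat r" "real_of_rat r < y"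
    using of_rat_dense[OF assms] by blast
  moreover obtain i where "r = nat_to_rat_surj i" using surj_nat_to_rat_surj by blast
  ultimately show thesis using that by (simp add: cut_def)
qed

text \<open>
  The infimum is taken in the extended reals, where it exists for every set, also for those that
  are not cuts.
\<close>

definition real_of_cut :: "nat set \<Rightarrow> real" where
  "real_of_cut w = real_of_ereal (INF i\<in>w. ereal (cut i))"

lemma real_of_cut: "real_of_cut {i. x \<le> cut i} = x"
proof -
  have "(INF i\<in>{i. x \<le> cut i}. ereal (cut i)) = ereal x"
  proof (rule antisym)
    show "ereal x \<le> (INF i\<in>{i. x \<le> cut i}. ereal (cut i))"
      by (rule INF_greatest) simp
    show "(INF i\<in>{i. x \<le> cut i}. ereal (cut i)) \<le> ereal x"
    proof (rule dense_ge)
      fix y assume "ereal x < y"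
      then obtain r where r: "x < r" "ereal r < y"
        using ereal_dense2[of "ereal x" y] by auto
      obtain i where i: "x < cut i" "cut i < r" using cut_dense[OF r(1)] .
      have "(INF i\<in>{i. x \<le> cut i}. ereal (cut i)) \<le> ereal (cut i)"
        by (rule INF_lower) (use i in simp)
      also have "\<dots> \<le> ereal r" using i by simp
      also have "\<dots> \<le> y" using r by simp
      finally show "(INF i\<in>{i. x \<le> cut i}. ereal (cut i)) \<le> y" .
    qed
  qed
  then show ?thesis by (simp add: real_of_cut_def)
qed

lemma measurable_real_of_cut:
  assumes "\<And>i. {x \<in> space M. i \<in> Z x} \<in> sets M"
  shows "(\<lambda>x. real_of_cut (Z x)) \<in> borel_measurable M"
proof -
  have "(INF i\<in>Z x. ereal (cut i)) = (INF i. if i \<in> Z x then ereal (cut i) else \<infinity>)"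
    (is "_ = (INF i. ?F i)") for x
  proof (rule antisym)
    show "(INF i\<in>Z x. ereal (cut i)) \<le> (INF i. ?F i)"
    proof (rule INF_greatest)
      fix i
      show "(INF i\<in>Z x. ereal (cut i)) \<le> ?F i"
        by (cases "i \<in> Z x") (auto intro: INF_lower)
    qed
    show "(INF i. ?F i) \<le> (INF i\<in>Z x. ereal (cut i))"
    proof (rule INF_greatest)
      fix i assume "i \<in> Z x"
      have "(INF i. ?F i) \<le> ?F i" by (rule INF_lower) (rule UNIV_I)
      also have "?F i = ereal (cut i)" using \<open>i \<in> Z x\<close> by (rule if_P)
      finally show "(INF i. ?F i) \<le> ereal (cut i)" .
    qed
  qed
  moreover have "(\<lambda>x. INF i. if i \<in> Z x then ereal (cut i) else \<infinity>) \<in> borel_measurable M"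
    using assms by (intro borel_measurable_INF measurable_If) (auto simp: pred_def)
  ultimately show ?thesis unfolding real_of_cut_def by simp
qed

section \<open>Lebesgue systems as images of hyperfinite cycles\<close>

lemma subset_Plus_iff: "J \<subseteq> B <+> C \<longleftrightarrow> Inl -` J \<subseteq> B \<and> Inr -` J \<subseteq> C"
  by (simp add: subset_iff split_sum_all Plus_def image_iff)

theorem corollary3:
  fixes U :: "('u, 'v) ns_universe"
    and X :: "'a measure" and \<tau> :: "'a \<Rightarrow> 'a"
  assumes "nonstandard_universe U"
    and "lebesgue_dynamical_system X \<tau>"
  shows "\<exists>(Y :: 'v set) (T :: 'v \<Rightarrow> 'v) (\<psi> :: 'v \<Rightarrow> 'a).
           transitive_loeb_system U Y T \<and>
           measure_preserving (loeb_measure U Y) X \<psi> \<and>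
           (AE y in loeb_measure U Y. \<psi> (T y) = \<tau> (\<psi> y))"
proof -
  interpret nonstandard U by unfold_locales (rule assms(1))
  have leb: "lebesgue_space X" and \<tau>: "measure_preserving X X \<tau>"
    using assms(2) by (simp_all add: lebesgue_dynamical_system_def)
  interpret X: prob_space X using leb by (simp add: lebesgue_space_def)
  have \<tau>m: "\<tau> \<in> measurable X X" using \<tau> by (simp add: measure_preserving_def)
  obtain c :: "'a \<Rightarrow> real" and d where c: "c \<in> borel_measurable X"
    and d: "d \<in> measurable (completion (distr X borel c)) X" and dc: "AE x in X. d (c x) = x"
    using lebesgue_space_decode[OF leb] .
  \<comment> \<open>A i is the event that the question c x \<le> cut i is answered yes.\<close>
  define A where "A = (\<lambda>i. {x \<in> space X. c x \<le> cut i})"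
  have A: "A i \<in> sets X" for i unfolding A_def using c by measurable
  obtain m z where mz: "(\<forall>n. n < m n) \<and> (\<forall>J J'. finite J \<longrightarrow> finite J' \<longrightarrow>
      (\<lambda>n. real (card {k. k < m n \<and> (\<forall>i\<in>J. z n k \<in> A i) \<and> (\<forall>i\<in>J'. z n (Suc k mod m n) \<in> A i)})
          / real (m n))
        \<longlonglongrightarrow> X.prob {x \<in> space X. (\<forall>i\<in>J. x \<in> A i) \<and> (\<forall>i\<in>J'. \<tau> x \<in> A i)})"
    using X.cyclic_approximation[OF \<tau>, of A, OF A] by (elim exE) (rule that)
  note m = conjunct1[OF mz, rule_format] and lim = conjunct2[OF mz, rule_format]
  obtain N where N: "infinite_hnat U N" using ex_infinite_hnat by blast
  then obtain M where M: "[N, M] \<in> star U {[num U n, num U (m n)] |n. True}"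
    using ex_star_value[of N m] by (auto simp: infinite_hnat_def)
  interpret nonstandard_cycle U m N M
    by unfold_locales (use m N M in auto)
  let ?L = "loeb_measure U Y"
  interpret L: prob_space ?L by (rule prob_space_loeb[OF M_hnat M_pos])
  have complete: "complete_measure ?L"
    unfolding loeb_measure_def by unfold_locales
  have spL: "space ?L = Y" by (rule space_loeb[OF M_hnat M_pos])
  have star_meas: "star_set Q \<in> sets ?L" for Q
    by (rule sets_loeb[OF M_hnat M_pos _ internal_star_set]) (simp add: star_set_def)
  define P where "P = (\<lambda>i n k. z n k \<in> A i)"
  \<comment> \<open>The random cuts: w y is the cut found at position y.  Z and V collect the answers at two
    consecutive times, on the cycle and in X; they will be seen to have the same law.\<close>
  define w where "w = (\<lambda>y. {i. y \<in> star_set (P i)})"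
  define Z where "Z = (\<lambda>y. w y <+> w (T y))"
  define V where "V = (\<lambda>x. {i. x \<in> A i} <+> {i. \<tau> x \<in> A i})"
  have cylinder: "{y \<in> Y. J \<subseteq> Z y} = star_set (\<lambda>n k. (\<forall>i\<in>Inl -` J. P i n k) \<and>
      (\<forall>i\<in>Inr -` J. P i n (Suc k mod m n)))" if J: "finite J" for J
  proof -
    have fin: "finite (Inl -` J)" "finite (Inr -` J)"
      using J by (auto intro: finite_vimageI)
    have "J \<subseteq> Z y \<longleftrightarrow> (\<forall>i\<in>Inl -` J. y \<in> star_set (P i)) \<and> (\<forall>i\<in>Inr -` J. T y \<in> star_set (P i))" for y
      unfolding Z_def w_def subset_Plus_iff by blast
    then show ?thesis
      unfolding star_set_conj star_set_ball[OF fin(1)] star_set_ball[OF fin(2)]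
      by (auto simp: T_star_set)
  qed
  have cylinder_V: "{x \<in> space X. J \<subseteq> V x} = {x \<in> space X. (\<forall>i\<in>Inl -` J. x \<in> A i) \<and>
      (\<forall>i\<in>Inr -` J. \<tau> x \<in> A i)}" for J
    unfolding V_def subset_Plus_iff by blast
  have Z: "Z \<in> measurable ?L incidence"
  proof (rule measurable_incidence)
    fix i
    have "{y \<in> space ?L. i \<in> Z y} = {y \<in> Y. {i} \<subseteq> Z y}" by (simp add: spL)
    then show "{y \<in> space ?L. i \<in> Z y} \<in> sets ?L"
      using cylinder[of "{i}"] star_meas by simp
  qed
  have V: "V \<in> measurable X incidence"
  proof (rule measurable_incidence)
    fix i
    have "{x \<in> space X. i \<in> V x} = (case i of Inl i \<Rightarrow> A i | Inr i \<Rightarrow> \<tau> -` A i \<inter> space X)"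
      using sets.sets_into_space[OF A] by (auto simp: V_def split: sum.split)
    then show "{x \<in> space X. i \<in> V x} \<in> sets X"
      using A measurable_sets[OF \<tau>m A] by (simp split: sum.split)
  qed
  have law: "distr ?L incidence Z = distr X incidence V"
  proof (rule incidence_eqI)
    show "finite_measure (distr ?L incidence Z)"
      by (rule L.finite_measure_distr[OF Z])
    fix J :: "(nat + nat) set" assume J: "finite J"
    have E: "{w. J \<subseteq> w} \<in> sets incidence"
      unfolding sets_incidence by (rule sigma_sets.Basic) (use J in blast)
    have fin: "finite (Inl -` J)" "finite (Inr -` J)"
      using J by (auto intro: finite_vimageI)
    have "emeasure (distr ?L incidence Z) {w. J \<subseteq> w} = emeasure ?L {y \<in> Y. J \<subseteq> Z y}"
      using Z E by (simp add: emeasure_distr vimage_def spL Int_def conj_commute)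
    also have "\<dots> = ennreal (X.prob {x \<in> space X. J \<subseteq> V x})"
      unfolding cylinder[OF J] cylinder_V
      by (rule loeb_star_set) (use lim[OF fin] in \<open>simp add: P_def\<close>)
    also have "\<dots> = emeasure (distr X incidence V) {w. J \<subseteq> w}"
      using V E by (simp add: emeasure_distr vimage_def Int_def conj_commute X.emeasure_eq_measure)
    finally show "emeasure (distr ?L incidence Z) {w. J \<subseteq> w} = emeasure (distr X incidence V) {w. J \<subseteq> w}" .
  qed simp_all
  define h where "h = (\<lambda>y. real_of_cut (w y))"
  \<comment> \<open>Decoding of the two components of a pair of cuts.\<close>
  define D1 where "D1 = (\<lambda>v :: (nat + nat) set. real_of_cut (Inl -` v))"
  define D2 where "D2 = (\<lambda>v :: (nat + nat) set. real_of_cut (Inr -` v))"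
  have D1: "D1 \<in> borel_measurable incidence" and D2: "D2 \<in> borel_measurable incidence"
    unfolding D1_def D2_def by (auto intro!: measurable_real_of_cut simp: incidence_mem)
  have D_Plus: "D1 (B <+> C) = real_of_cut B" "D2 (B <+> C) = real_of_cut C" for B C
  proof -
    have "Inl -` (B <+> C) = B" "Inr -` (B <+> C) = C" by auto
    then show "D1 (B <+> C) = real_of_cut B" "D2 (B <+> C) = real_of_cut C"
      by (simp_all add: D1_def D2_def)
  qed
  have hZ: "h y = D1 (Z y)" "h (T y) = D2 (Z y)" for y
    by (simp_all add: h_def Z_def D_Plus)
  have cut_A: "real_of_cut {i. x \<in> A i} = c x" if "x \<in> space X" for x
    using that real_of_cut[of "c x"] by (simp add: A_def)
  have cV: "D1 (V x) = c x" "D2 (V x) = c (\<tau> x)" if "x \<in> space X" for x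
    using that measurable_space[OF \<tau>m that] by (simp_all add: V_def D_Plus cut_A)
  have h: "h \<in> borel_measurable ?L"
    unfolding hZ(1)[abs_def] by (rule measurable_compose[OF Z D1])
  have "distr ?L borel h = distr (distr ?L incidence Z) borel D1"
    using Z D1 by (simp add: distr_distr comp_def hZ(1)[abs_def])
  also have "\<dots> = distr X borel (\<lambda>x. D1 (V x))"
    unfolding law using V D1 by (simp add: distr_distr comp_def)
  also have "\<dots> = distr X borel c"
    by (rule distr_cong) (simp_all add: cV)
  finally have law_h: "distr ?L borel h = distr X borel c" .
  define \<psi> where "\<psi> = (\<lambda>y. d (h y))"
  have \<psi>: "measure_preserving ?L X \<psi>"
    unfolding \<psi>_def by (rule measure_preserving_decode[OF c d dc complete h law_h])
  have "(\<lambda>r. c (\<tau> (d r))) \<in> borel_measurable (completion (distr X borel c))"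
    by (rule measurable_compose[OF d measurable_compose[OF \<tau>m c]])
  \<comment> \<open>In the code, the transformation is given by a measurable function for the completed law only;
    g is a Borel version of it, so that its graph is an event for the law of pairs of cuts.\<close>
  then obtain g where g: "g \<in> borel_measurable (distr X borel c)"
    and g_eq: "AE r in distr X borel c. c (\<tau> (d r)) = g r"
    using completion_ex_borel_measurable_real by blast
  have gb: "g \<in> borel_measurable borel" using g by simp
  have "AE x in X. c (\<tau> x) = g (c x)"
    using AE_distrD[OF c g_eq] dc by eventually_elim simp
  then have "AE x in X. D2 (V x) = g (D1 (V x))"
    by (rule AE_mp) (rule AE_I2, simp add: cV)
  moreover have graph: "{v \<in> space incidence. D2 v = g (D1 v)} \<in> sets incidence"
    using D1 D2 gb by measurable
  ultimately have "AE v in distr ?L incidence Z. D2 v = g (D1 v)"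
    unfolding law AE_distr_iff[OF V graph] by blast
  then have "AE y in ?L. D2 (Z y) = g (D1 (Z y))"
    by (rule AE_distrD[OF Z])
  moreover have "AE y in ?L. c (\<tau> (d (h y))) = g (h y)"
    using g_eq unfolding law_h[symmetric] by (rule AE_distrD[OF h])
  moreover have "AE y in ?L. d (c (\<tau> (\<psi> y))) = \<tau> (\<psi> y)"
  proof -
    have "AE x in distr X X \<tau>. d (c x) = x"
      unfolding distr_measure_preserving[OF \<tau>] by (rule dc)
    then have "AE x in X. d (c (\<tau> x)) = \<tau> x" by (rule AE_distrD[OF \<tau>m])
    then have "AE x in distr ?L X \<psi>. d (c (\<tau> x)) = \<tau> x"
      unfolding distr_measure_preserving[OF \<psi>] .
    moreover have "\<psi> \<in> measurable ?L X" using \<psi> by (simp add: measure_preserving_def)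
    ultimately show ?thesis by (rule AE_distrD[rotated])
  qed
  ultimately have "AE y in ?L. \<psi> (T y) = \<tau> (\<psi> y)"
    by eventually_elim (simp add: \<psi>_def hZ[symmetric])
  then show ?thesis using transitive_T \<psi> by blast
qed

end
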